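(* Let $a,b,c$ be positive integers and let $W$ be a complex vector space with basis $\{e_T\}$ indexed by the plane partitions $T$ in an $a\times b\times c$ box. Let $\tilde\kappa:W\to W$ be the linear map with $\tilde\kappa(e_T)=e_{\kappa(T)}$, and let $\nu:W\to W$ be the linear map with $\nu(e_T)=(-1)^{|T|}e_T$ (negating the basis vectors of plane partitions with an odd number of cubes). Then $\tilde\kappa$ and $\nu$ are linearly conjugate: there is an invertible linear map $g:W\to W$ with $g\,\tilde\kappa\,g^{-1}=\nu$.
   Context: A plane partition in an $a\times b\times c$ box is a set $T$ of triples $(i,j,k)$ of integers with $1\le i\le a$, $1\le j\le b$, $1\le k\le c$ (unit cubes) such that whenever $(i,j,k)\in T$ and $1\le i'\le i$, $1\le j'\le j$, $1\le k'\le k$, then $(i',j',k')\in T$; $|T|$ denotes the number of cubes in $T$. The complement $\kappa(T)$ is the plane partition $\{(i,j,k): (a+1-i,\,b+1-j,\,c+1-k)\notin T\}$ (the cubes of the box not in $T$, with all three coordinates of the box reversed). *)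

theory Defs
  imports Complex_Main
begin

definition pp_box :: "nat \<Rightarrow> nat \<Rightarrow> nat \<Rightarrow> (nat \<times> nat \<times> nat) set" where
  "pp_box a b c = {1..a} \<times> {1..b} \<times> {1..c}"

definition plane_partitions :: "nat \<Rightarrow> nat \<Rightarrow> nat \<Rightarrow> (nat \<times> nat \<times> nat) set set" where
  "plane_partitions a b c =
    {T. T \<subseteq> pp_box a b c \<and>
        (\<forall>i j k i' j' k'.
           (i, j, k) \<in> T \<and> 1 \<le> i' \<and> i' \<le> i \<and> 1 \<le> j' \<and> j' \<le> j \<and> 1 \<le> k' \<and> k' \<le> k
             \<longrightarrow> (i', j', k') \<in> T)}"

text \<open>The triples range over the box, so the natural-number subtractions never truncate.\<close>

definition pp_complement ::
  "nat \<Rightarrow> nat \<Rightarrow> nat \<Rightarrow> (nat \<times> nat \<times> nat) set \<Rightarrow> (nat \<times> nat \<times> nat) set" where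
  "pp_complement a b c T =
    {(i, j, k). (i, j, k) \<in> pp_box a b c \<and> (a + 1 - i, b + 1 - j, c + 1 - k) \<notin> T}"

text \<open>The vectors \<open>e x\<close>, for \<open>x\<close> in \<open>I\<close>, are pairwise distinct and form a basis of the whole
  space; the values of \<open>e\<close> outside \<open>I\<close> are irrelevant.\<close>

definition basis_indexed_by ::
  "('k::field \<Rightarrow> 'v::ab_group_add \<Rightarrow> 'v) \<Rightarrow> 'i set \<Rightarrow> ('i \<Rightarrow> 'v) \<Rightarrow> bool" where
  "basis_indexed_by scale I e \<longleftrightarrow>
    inj_on e I \<and> \<not> module.dependent scale (e ` I) \<and> module.span scale (e ` I) = UNIV"

end

theory Submission
  imports
    Defs
    "HOL-Library.Multiset"
    "HOL-Library.FuncSet"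
    "HOL-Library.Infinite_Set"
    "HOL-Combinatorics.Permutations"
    "HOL-Computational_Algebra.Polynomial"
begin

text \<open>
  Put \<open>n = a + b\<close>. The layers of a plane partition \<open>T\<close> are \<open>c\<close> nested partitions in an \<open>a \<times> b\<close> box,
  that is, a chain of \<open>c\<close> subsets of \<open>{..<n}\<close> of size \<open>a\<close>; let \<open>p T\<close> be the product of the
  corresponding maximal minors of a generic \<open>n \<times> a\<close> matrix. By Hodge's standard monomial theorem
  the \<open>p T\<close> form a basis of the degree-\<open>c\<close> part of the coordinate ring of the Grassmannian, on which
  \<open>GL(n)\<close> acts through row operations. Reversing the order of the rows sends \<open>p T\<close> to
  \<open>\<epsilon> p (\<kappa> T)\<close>, and alternating the signs of the rows sends \<open>p T\<close> to \<open>\<epsilon> (-1)\<^sup>|\<^sup>T\<^sup>| p T\<close>, with the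
  same sign \<open>\<epsilon>\<close>. The two row operations are conjugate in \<open>GL(n)\<close>, since both are involutions with
  eigenvalue \<open>1\<close> of multiplicity \<open>\<lceil>n/2\<rceil>\<close>; hence so are the two maps on the degree-\<open>c\<close> part.
\<close>

section \<open>Minors and the Garnir relations\<close>

text \<open>Rows are given by a function instead of a set, so that the unsorted and repeated rows
  arising from exchanges and row expansions still name a minor.\<close>

definition minor :: "nat \<Rightarrow> (nat \<Rightarrow> nat) \<Rightarrow> (nat \<Rightarrow> nat \<Rightarrow> 'a::comm_ring_1) \<Rightarrow> 'a" where
  "minor a f X = (\<Sum>\<sigma> | \<sigma> permutes {..<a}. of_int (sign \<sigma>) * (\<Prod>i<a. X (f i) (\<sigma> i)))"

lemma minor_cong:
  assumes "\<And>i. i < a \<Longrightarrow> f i = g i"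
  shows "minor a f X = minor a g X"
  unfolding minor_def using assms by simp

lemma sign_permutes_compose:
  assumes "finite A" "p permutes A" "q permutes A"
  shows "sign (p \<circ> q) = sign p * sign q"
  using assms by (metis permutation_permutes sign_compose)

lemma minor_permute:
  assumes "\<pi> permutes {..<a}"
  shows "minor a (f \<circ> \<pi>) X = of_int (sign \<pi>) * minor a f X"
proof -
  have "minor a (f \<circ> \<pi>) X = (\<Sum>\<sigma> | \<sigma> permutes {..<a}. of_int (sign (\<sigma> \<circ> \<pi>)) *
      (\<Prod>i<a. X ((f \<circ> \<pi>) i) ((\<sigma> \<circ> \<pi>) i)))"
    unfolding minor_def by (rule sum_permutations_compose_right[OF assms])
  also have "\<dots> = (\<Sum>\<sigma> | \<sigma> permutes {..<a}. of_int (sign \<pi>) *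
      (of_int (sign \<sigma>) * (\<Prod>i<a. X (f i) (\<sigma> i))))"
  proof (intro sum.cong refl)
    fix \<sigma> assume "\<sigma> \<in> {\<sigma>. \<sigma> permutes {..<a}}"
    then have "sign (\<sigma> \<circ> \<pi>) = sign \<sigma> * sign \<pi>"
      using assms by (simp add: sign_permutes_compose[of "{..<a}"])
    moreover have "(\<Prod>i<a. X ((f \<circ> \<pi>) i) ((\<sigma> \<circ> \<pi>) i)) = (\<Prod>i<a. X (f i) (\<sigma> i))"
      using prod.permute[OF assms, of "\<lambda>i. X (f i) (\<sigma> i)"] by (simp add: o_def)
    ultimately show "of_int (sign (\<sigma> \<circ> \<pi>)) * (\<Prod>i<a. X ((f \<circ> \<pi>) i) ((\<sigma> \<circ> \<pi>) i)) =
        of_int (sign \<pi>) * (of_int (sign \<sigma>) * (\<Prod>i<a. X (f i) (\<sigma> i)))"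
      by (simp add: mult_ac)
  qed
  finally show ?thesis
    unfolding minor_def by (simp add: sum_distrib_left)
qed

text \<open>Composing with the transposition flips the sign and keeps \<open>F\<close>, so the sum
  equals its own negative.\<close>

lemma alternating_sum_eq_0:
  fixes F :: "('b \<Rightarrow> 'b) \<Rightarrow> 'a::{idom,ring_char_0}"
  assumes "finite S" "x \<in> S" "y \<in> S" "x \<noteq> y"
    and F: "\<And>\<pi>. \<pi> permutes S \<Longrightarrow> F (\<pi> \<circ> Transposition.transpose x y) = F \<pi>"
  shows "(\<Sum>\<pi> | \<pi> permutes S. of_int (sign \<pi>) * F \<pi>) = 0"
proof -
  let ?t = "Transposition.transpose x y"
  have t: "?t permutes S"
    using assms by (simp add: permutes_swap_id)
  have "(\<Sum>\<pi> | \<pi> permutes S. of_int (sign \<pi>) * F \<pi>) =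
      (\<Sum>\<pi> | \<pi> permutes S. of_int (sign (\<pi> \<circ> ?t)) * F (\<pi> \<circ> ?t))"
    by (rule sum_permutations_compose_right[OF t])
  also have "\<dots> = (\<Sum>\<pi> | \<pi> permutes S. - (of_int (sign \<pi>) * F \<pi>))"
    using assms t by (intro sum.cong) (auto simp: sign_permutes_compose[of S] sign_swap_id)
  finally show ?thesis
    by (simp add: sum_negf)
qed

lemma minor_eq_0:
  fixes X :: "nat \<Rightarrow> nat \<Rightarrow> 'a::{idom,ring_char_0}"
  assumes "\<not> inj_on f {..<a}"
  shows "minor a f X = 0"
proof -
  obtain i j where ij: "i < a" "j < a" "i \<noteq> j" "f i = f j"
    using assms by (auto simp: inj_on_def)
  let ?t = "Transposition.transpose i j"
  have t: "?t permutes {..<a}"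
    using ij by (simp add: permutes_swap_id)
  have "f \<circ> ?t = f"
    using ij by (auto simp: Transposition.transpose_def)
  then have "minor a f X = - minor a f X"
    using minor_permute[OF t, of f X] ij by (simp add: sign_swap_id)
  then show ?thesis
    by simp
qed

text \<open>Multilinearity in the rows: \<open>h\<close> records the summand chosen in each row.
  This is Cauchy-Binet before terms with the same image are collected.\<close>

lemma minor_linear_rows:
  "minor a f (\<lambda>k j. \<Sum>l<n. P k l * X l j) =
    (\<Sum>h\<in>PiE {..<a} (\<lambda>_. {..<n}). (\<Prod>i<a. P (f i) (h i)) * minor a h X)"
proof -
  let ?H = "PiE {..<a} (\<lambda>_. {..<n})"
  have "minor a f (\<lambda>k j. \<Sum>l<n. P k l * X l j) =
     (\<Sum>\<sigma> | \<sigma> permutes {..<a}. \<Sum>h\<in>?H. of_int (sign \<sigma>) *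
        ((\<Prod>i<a. P (f i) (h i)) * (\<Prod>i<a. X (h i) (\<sigma> i))))"
    unfolding minor_def by (subst prod_sum_PiE) (simp_all add: prod.distrib sum_distrib_left)
  also have "\<dots> = (\<Sum>h\<in>?H. \<Sum>\<sigma> | \<sigma> permutes {..<a}. of_int (sign \<sigma>) *
        ((\<Prod>i<a. P (f i) (h i)) * (\<Prod>i<a. X (h i) (\<sigma> i))))"
    by (rule sum.swap)
  finally show ?thesis
    unfolding minor_def by (simp add: sum_distrib_left mult_ac)
qed

lemma prod_lessThan_add:
  fixes F :: "nat \<Rightarrow> 'a::comm_monoid_mult"
  shows "(\<Prod>m<a + b. F m) = (\<Prod>i<a. F i) * (\<Prod>j<b. F (a + j))"
  by (induction b) (simp_all add: mult.assoc)

text \<open>Antisymmetrizing over \<open>a + 1\<close> row positions gives zero: in each term of the Leibniz expansion two of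
  these positions share one of the \<open>a\<close> columns. Positions \<open>m < a\<close> belong to the first minor and
  positions \<open>a + i\<close> to the second.\<close>

lemma garnir_relation:
  fixes X :: "nat \<Rightarrow> nat \<Rightarrow> 'a::{idom,ring_char_0}"
  assumes "q < a"
  shows "(\<Sum>\<pi> | \<pi> permutes {q..a + q}. of_int (sign \<pi>) *
      (minor a (\<lambda>i. u (\<pi> i)) X * minor a (\<lambda>i. u (\<pi> (a + i))) X)) = 0"
proof -
  let ?P = "{\<pi>. \<pi> permutes {q..a + q}}" and ?S = "{\<sigma>. \<sigma> permutes {..<a}}"
  \<comment> \<open>A pair of Leibniz terms assigns a column to each of the \<open>a + a\<close>
    positions; \<open>h\<close> glues the two assignments.\<close>
  define h where "h \<sigma> \<tau> m = (if m < a then \<sigma> m else \<tau> (m - a))" for \<sigma> \<tau> :: "nat \<Rightarrow> nat" and m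
  have prod_h: "(\<Prod>i<a. X (u (\<pi> i)) (\<sigma> i)) * (\<Prod>i<a. X (u (\<pi> (a + i))) (\<tau> i)) =
      (\<Prod>m<a + a. X (u (\<pi> m)) (h \<sigma> \<tau> m))" for \<pi> \<sigma> \<tau>
    by (simp add: prod_lessThan_add h_def)
  have vanish: "(\<Sum>\<pi>\<in>?P. of_int (sign \<pi>) * (\<Prod>m<a + a. X (u (\<pi> m)) (h \<sigma> \<tau> m))) = 0"
    if "\<sigma> \<in> ?S" "\<tau> \<in> ?S" for \<sigma> \<tau>
  proof -
    have "h \<sigma> \<tau> ` {q..a + q} \<subseteq> {..<a}"
    proof -
      have "\<sigma> m < a" "\<tau> m < a" if "m < a" for m
        using permutes_in_image[of \<sigma> "{..<a}" m] permutes_in_image[of \<tau> "{..<a}" m] that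
          \<open>\<sigma> \<in> ?S\<close> \<open>\<tau> \<in> ?S\<close> by auto
      then show ?thesis
        using assms by (auto simp: h_def)
    qed
    then have "card (h \<sigma> \<tau> ` {q..a + q}) < card {q..a + q}"
      using card_mono[of "{..<a}" "h \<sigma> \<tau> ` {q..a + q}"] by simp
    then have "\<not> inj_on (h \<sigma> \<tau>) {q..a + q}"
      using pigeonhole by blast
    then obtain x y where xy: "x \<in> {q..a + q}" "y \<in> {q..a + q}" "x \<noteq> y" "h \<sigma> \<tau> x = h \<sigma> \<tau> y"
      by (auto simp: inj_on_def)
    let ?t = "Transposition.transpose x y"
    have t: "?t permutes {..<a + a}"
      using xy assms by (intro permutes_swap_id) auto
    have ht: "h \<sigma> \<tau> (?t m) = h \<sigma> \<tau> m" for m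
      using xy by (auto simp: Transposition.transpose_def)
    show ?thesis
    proof (rule alternating_sum_eq_0[of _ x y])
      fix \<pi>
      have "(\<Prod>m<a + a. X (u ((\<pi> \<circ> ?t) m)) (h \<sigma> \<tau> m)) =
          (\<Prod>m<a + a. X (u (\<pi> (?t m))) (h \<sigma> \<tau> (?t m)))"
        by (simp add: ht)
      then show "(\<Prod>m<a + a. X (u ((\<pi> \<circ> ?t) m)) (h \<sigma> \<tau> m)) = (\<Prod>m<a + a. X (u (\<pi> m)) (h \<sigma> \<tau> m))"
        using prod.permute[OF t, of "\<lambda>m. X (u (\<pi> m)) (h \<sigma> \<tau> m)"] by (simp add: o_def)
    qed (use xy in auto)
  qed
  have "(\<Sum>\<pi>\<in>?P. of_int (sign \<pi>) *
      (minor a (\<lambda>i. u (\<pi> i)) X * minor a (\<lambda>i. u (\<pi> (a + i))) X)) =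
    (\<Sum>\<pi>\<in>?P. \<Sum>\<sigma>\<in>?S. \<Sum>\<tau>\<in>?S. of_int (sign \<sigma>) * of_int (sign \<tau>) *
      (of_int (sign \<pi>) * (\<Prod>m<a + a. X (u (\<pi> m)) (h \<sigma> \<tau> m))))"
    unfolding minor_def sum_product unfolding sum_distrib_left prod_h[symmetric]
    by (intro sum.cong refl) (simp add: mult_ac)
  also have "\<dots> = (\<Sum>\<sigma>\<in>?S. \<Sum>\<pi>\<in>?P. \<Sum>\<tau>\<in>?S. of_int (sign \<sigma>) * of_int (sign \<tau>) *
      (of_int (sign \<pi>) * (\<Prod>m<a + a. X (u (\<pi> m)) (h \<sigma> \<tau> m))))"
    by (rule sum.swap)
  also have "\<dots> = (\<Sum>\<sigma>\<in>?S. \<Sum>\<tau>\<in>?S. \<Sum>\<pi>\<in>?P. of_int (sign \<sigma>) * of_int (sign \<tau>) *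
      (of_int (sign \<pi>) * (\<Prod>m<a + a. X (u (\<pi> m)) (h \<sigma> \<tau> m))))"
    by (intro sum.cong refl sum.swap)
  also have "\<dots> = 0"
    by (rule sum.neutral, rule ballI, rule sum.neutral, rule ballI)
      (simp only: sum_distrib_left[symmetric] vanish mult_zero_right)
  finally show ?thesis .
qed

lemma exists_sorting_permutation:
  fixes f :: "nat \<Rightarrow> nat"
  assumes "inj_on f {..<a}"
  obtains \<pi> where "\<pi> permutes {..<a}" "strict_mono_on {..<a} (f \<circ> \<pi>)"
proof -
  obtain h where h: "bij_betw h {..<a} (f ` {..<a})" "strict_mono_on {..<a} h"
    using ex_bij_betw_strict_mono_card[of "f ` {..<a}"] assms by (auto simp: card_image)
  define \<pi> where "\<pi> i = (if i < a then inv_into {..<a} f (h i) else i)" for i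
  have inv: "bij_betw (inv_into {..<a} f) (f ` {..<a}) {..<a}"
    using assms by (simp add: bij_betw_inv_into inj_on_imp_bij_betw)
  have "bij_betw (inv_into {..<a} f \<circ> h) {..<a} {..<a}"
    using bij_betw_trans[OF h(1) inv] .
  then have "bij_betw \<pi> {..<a} {..<a}"
    by (rule bij_betw_cong[THEN iffD1, rotated]) (simp add: \<pi>_def)
  then have "\<pi> permutes {..<a}"
    by (rule bij_imp_permutes) (simp add: \<pi>_def)
  moreover have "f (\<pi> i) = h i" if "i < a" for i
    using that h(1) by (auto simp: \<pi>_def bij_betw_def intro!: f_inv_into_f)
  then have "strict_mono_on {..<a} (f \<circ> \<pi>)"
    using h(2) by (auto simp: strict_mono_on_def)
  ultimately show ?thesis
    using that by blast
qed

text \<open>Trade each element of \<open>A - A'\<close> for one of \<open>A' - A\<close> along a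
  bijection: the elements that enter come from \<open>S - A\<close> and have smaller values than
  those that leave.\<close>

lemma sum_image_exchange_less:
  fixes u :: "nat \<Rightarrow> nat"
  assumes fin: "finite S" "A \<subseteq> S" "A' \<subseteq> S" and card: "card A' = card A" and ne: "A' \<noteq> A"
    and less: "\<And>x y. x \<in> A \<Longrightarrow> y \<in> S - A \<Longrightarrow> u y < u x"
  shows "sum u A' < sum u A"
proof -
  have fA: "finite A" "finite A'"
    using fin finite_subset by auto
  have card': "card (A' - A) = card (A - A')"
    using card fA by (simp add: card_Diff_subset_Int Int_commute)
  have "A - A' \<noteq> {}"
    using ne card fA card_subset_eq[of A' A] by auto
  then have pos: "0 < card (A - A')"
    using fA by (simp add: card_gt_0_iff)
  obtain g where g: "bij_betw g (A - A') (A' - A)"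
    using finite_same_card_bij[of "A - A'" "A' - A"] card' fA by auto
  have "sum u (A' - A) = (\<Sum>x\<in>A - A'. u (g x))"
    using sum.reindex_bij_betw[OF g, of u] by simp
  also have "\<dots> < sum u (A - A')"
    using \<open>A - A' \<noteq> {}\<close> fA g fin by (intro sum_strict_mono less) (auto simp: bij_betw_def)
  finally have "sum u (A' - A) < sum u (A - A')" .
  moreover have "sum u A' = sum u (A' \<inter> A) + sum u (A' - A)" "sum u A = sum u (A' \<inter> A) + sum u (A - A')"
    using sum.Int_Diff[OF fA(2), of u A] sum.Int_Diff[OF fA(1), of u A'] by (simp_all add: Int_commute)
  ultimately show ?thesis
    by simp
qed

text \<open>Preserving \<open>{q..<a}\<close> makes \<open>\<pi>\<close> preserve
  \<open>{..<a}\<close>, so it splits into one permutation of the rows of each minor. Their signs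
  multiply to \<open>sign \<pi>\<close> and cancel it, hence these Garnir terms all equal the
  identity term.\<close>

lemma block_permutation_term:
  fixes X :: "nat \<Rightarrow> nat \<Rightarrow> 'a::comm_ring_1"
  assumes q: "q < a" and \<pi>: "\<pi> permutes {q..a + q}" and block: "\<pi> ` {q..<a} = {q..<a}"
  shows "of_int (sign \<pi>) * (minor a (\<lambda>i. u (\<pi> i)) X * minor a (\<lambda>i. u (\<pi> (a + i))) X) =
    minor a u X * minor a (\<lambda>i. u (a + i)) X"
proof -
  define \<pi>1 where "\<pi>1 x = (if x < a then \<pi> x else x)" for x
  define \<pi>2 where "\<pi>2 i = (if i < a then \<pi> (a + i) - a else i)" for i
  \<comment> \<open>\<open>\<pi>2'\<close> acts on the positions \<open>{a..<a + a}\<close>;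
    \<open>\<pi>2\<close> is its shift down to \<open>{..<a}\<close>, and
    \<open>map_permutation\<close> below carries over the sign.\<close>
  define \<pi>2' where "\<pi>2' x = (if x < a then x else \<pi> x)" for x
  have inj: "inj \<pi>"
    using \<pi> by (simp add: permutes_inj)
  have fix_low: "\<pi> x = x" if "x < q" for x
    using permutes_not_in[OF \<pi>] that by simp
  have img: "\<pi> ` {..<a} = {..<a}"
  proof -
    have "{..<a} = {..<q} \<union> {q..<a}" using q by auto
    moreover have "\<pi> ` {..<q} = {..<q}" using fix_low by (auto simp: image_iff)
    ultimately show ?thesis using block by (simp add: image_Un)
  qed
  have lt: "\<pi> x < a \<longleftrightarrow> x < a" for x
  proof
    assume "\<pi> x < a"
    then have "\<pi> x \<in> \<pi> ` {..<a}" unfolding img by simp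
    then show "x < a" unfolding inj_image_mem_iff[OF inj] by simp
  next
    assume "x < a"
    then have "\<pi> x \<in> \<pi> ` {..<a}" by simp
    then show "\<pi> x < a" unfolding img by simp
  qed
  have full: "\<pi> permutes {..<a + a}"
    using \<pi> by (rule permutes_subset) (use q in auto)
  have p1: "\<pi>1 permutes {..<a}"
  proof (rule bij_imp_permutes)
    show "bij_betw \<pi>1 {..<a} {..<a}"
      using bij_betw_imageI[OF inj_on_subset[OF inj subset_UNIV] img]
      by (rule bij_betw_cong[THEN iffD1, rotated]) (simp add: \<pi>1_def)
  qed (simp add: \<pi>1_def)
  have img2: "\<pi> ` {a..<a + a} = {a..<a + a}"
  proof -
    have "{a..<a + a} = {..<a + a} - {..<a}" by auto
    then show ?thesis
      using image_set_diff[OF inj, of "{..<a + a}" "{..<a}"] permutes_image[OF full] img by simp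
  qed
  have p2': "\<pi>2' permutes {a..<a + a}"
  proof (rule bij_imp_permutes)
    show "bij_betw \<pi>2' {a..<a + a} {a..<a + a}"
      using bij_betw_imageI[OF inj_on_subset[OF inj subset_UNIV] img2]
      by (rule bij_betw_cong[THEN iffD1, rotated]) (simp add: \<pi>2'_def)
    fix x assume "x \<notin> {a..<a + a}"
    then show "\<pi>2' x = x"
      using permutes_not_in[OF full, of x] by (simp add: \<pi>2'_def)
  qed
  have p2: "\<pi>2 permutes {..<a}" and s2: "sign \<pi>2 = sign \<pi>2'"
  proof -
    have shift: "bij_betw (\<lambda>x. x - a) {a..<a + a} {..<a}"
      by (rule bij_betwI[of _ _ _ "\<lambda>x. x + a"]) auto
    then have inj_shift: "inj_on (\<lambda>x. x - a) {a..<a + a}" and img_shift: "(\<lambda>x. x - a) ` {a..<a + a} = {..<a}"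
      by (auto simp: bij_betw_def)
    have "map_permutation {a..<a + a} (\<lambda>x. x - a) \<pi>2' i = \<pi>2 i" for i
    proof (cases "i < a")
      case True
      then show ?thesis
        using map_permutation_apply[OF inj_shift, of "a + i" \<pi>2'] by (simp add: \<pi>2_def \<pi>2'_def)
    next
      case False
      then have "i \<notin> (\<lambda>x. x - a) ` {a..<a + a}"
        by (simp add: img_shift)
      then show ?thesis
        using False by (simp add: map_permutation_def \<pi>2_def restrict_id_def)
    qed
    then have m: "map_permutation {a..<a + a} (\<lambda>x. x - a) \<pi>2' = \<pi>2" ..
    show "\<pi>2 permutes {..<a}"
      using map_permutation_permutes[OF shift p2'] m by simp
    show "sign \<pi>2 = sign \<pi>2'"
      using sign_map_permutation[OF inj_shift p2'] m by simp
  qed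
  have comp: "\<pi> = \<pi>1 \<circ> \<pi>2'"
    using lt by (auto simp: \<pi>1_def \<pi>2'_def fun_eq_iff)
  have "sign \<pi> = sign \<pi>1 * sign \<pi>2"
    unfolding s2 comp using p1 p2'
    by (intro sign_compose) (auto simp: permutation_permutes)
  moreover have "minor a (\<lambda>i. u (\<pi> i)) X = of_int (sign \<pi>1) * minor a u X"
    unfolding minor_permute[OF p1, symmetric] by (rule minor_cong) (simp add: \<pi>1_def)
  moreover have "minor a (\<lambda>i. u (\<pi> (a + i))) X = of_int (sign \<pi>2) * minor a (\<lambda>i. u (a + i)) X"
    unfolding minor_permute[OF p2, symmetric]
  proof (rule minor_cong)
    fix i assume "i < a"
    moreover have "a \<le> \<pi> (a + i)"
      using lt[of "a + i"] by simp
    ultimately show "u (\<pi> (a + i)) = ((\<lambda>i. u (a + i)) \<circ> \<pi>2) i"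
      by (simp add: \<pi>2_def)
  qed
  ultimately show ?thesis
    by (cases \<pi>1 rule: sign_cases; cases \<pi>2 rule: sign_cases) simp_all
qed

section \<open>Straightening\<close>

text \<open>Convexity: with the total fixed, moving the smaller number down and the larger one up by
  \<open>d\<close> adds \<open>2 * d * (t - s')\<close> to the sum of squares, and this is
  positive.\<close>

lemma square_sum_spread:
  fixes s t s' t' :: nat
  assumes "s + t = s' + t'" "s \<le> t" "s' < s"
  shows "s\<^sup>2 + t\<^sup>2 < s'\<^sup>2 + t'\<^sup>2"
proof -
  obtain d where d: "s = s' + d" "d > 0"
    using assms(3) by (metis less_imp_add_positive)
  have t': "t' = t + d"
    using assms(1) d by simp
  have "d * s' < d * t"
    using d assms by simp
  moreover have "(s' + d)\<^sup>2 + t\<^sup>2 + 2 * (d * t) = s'\<^sup>2 + (t + d)\<^sup>2 + 2 * (d * s')"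
    by (simp add: power2_eq_square algebra_simps)
  ultimately show ?thesis
    unfolding t' d(1) by linarith
qed

text \<open>At a violation \<open>g q < f q\<close> all of \<open>g 0, \<dots>, g q\<close> are smaller than all of \<open>f q, \<dots>, f (a - 1)\<close>, so every
  nontrivial exchange in the Garnir relation lowers the row sum of the first factor. Since that sum was the
  smaller one, the sum of the squares grows, which makes straightening terminate.\<close>

lemma minor_product_straighten:
  fixes f g :: "nat \<Rightarrow> nat"
  assumes f: "strict_mono_on {..<a} f" "\<And>i. i < a \<Longrightarrow> f i < n"
    and g: "strict_mono_on {..<a} g" "\<And>i. i < a \<Longrightarrow> g i < n"
    and le: "sum f {..<a} \<le> sum g {..<a}" and q: "q < a" "g q < f q"
  obtains Q :: "(nat \<Rightarrow> nat) set" and d :: complex and F G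
  where "finite Q"
    and "\<And>\<pi> i. \<pi> \<in> Q \<Longrightarrow> i < a \<Longrightarrow> F \<pi> i < n \<and> G \<pi> i < n"
    and "\<And>\<pi>. \<pi> \<in> Q \<Longrightarrow> (sum f {..<a})\<^sup>2 + (sum g {..<a})\<^sup>2 < (sum (F \<pi>) {..<a})\<^sup>2 + (sum (G \<pi>) {..<a})\<^sup>2"
    and "\<And>X :: nat \<Rightarrow> nat \<Rightarrow> complex. minor a f X * minor a g X =
      (\<Sum>\<pi>\<in>Q. d * of_int (sign \<pi>) * (minor a (F \<pi>) X * minor a (G \<pi>) X))"
proof -
  define u where "u m = (if m < a then f m else g (m - a))" for m
  let ?P = "{\<pi>. \<pi> permutes {q..a + q}}"
  \<comment> \<open>By \<open>block_permutation_term\<close> each element of \<open>K\<close>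
    contributes the original product. The Garnir relation is solved for it by dividing by
    \<open>card K\<close>, which is nonzero because \<open>id\<close> is in
    \<open>K\<close>.\<close>
  define K where "K = {\<pi> \<in> ?P. \<pi> ` {q..<a} = {q..<a}}"
  define Q where "Q = ?P - K"
  define F where "F \<pi> = (\<lambda>i. u (\<pi> i))" for \<pi> :: "nat \<Rightarrow> nat"
  define G where "G \<pi> = (\<lambda>i. u (\<pi> (a + i)))" for \<pi> :: "nat \<Rightarrow> nat"
  have finP: "finite ?P"
    by (simp add: finite_permutations)
  have "id \<in> K"
    by (simp add: K_def permutes_id)
  moreover have "finite K"
    using finP by (simp add: K_def)
  ultimately have K0: "card K \<noteq> 0"
    by auto
  have full: "\<pi> permutes {..<a + a}" if "\<pi> \<in> ?P" for \<pi>
    using that q by (auto intro: permutes_subset)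
  show ?thesis
  proof (rule that[of Q F G "- (1 / of_nat (card K))"])
    show "finite Q"
      using finP by (simp add: Q_def)
  next
    fix \<pi> i assume \<pi>: "\<pi> \<in> Q" and i: "i < a"
    have "u m < n" if "m < a + a" for m
      using that f(2) g(2) by (auto simp: u_def)
    moreover have "\<pi> i < a + a" "\<pi> (a + i) < a + a"
      using permutes_in_image[OF full, of \<pi> i] permutes_in_image[OF full, of \<pi> "a + i"] \<pi> i
      by (auto simp: Q_def)
    ultimately show "F \<pi> i < n \<and> G \<pi> i < n"
      by (simp add: F_def G_def)
  next
    fix \<pi> assume \<pi>: "\<pi> \<in> Q"
    then have perm: "\<pi> permutes {q..a + q}" and ne: "\<pi> ` {q..<a} \<noteq> {q..<a}"
      by (auto simp: Q_def K_def)
    have inj: "inj \<pi>"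
      using perm by (rule permutes_inj)
    have split: "{..<a} = {..<q} \<union> {q..<a}"
      using q by auto
    \<comment> \<open>Positions below \<open>q\<close> are fixed, so the first row sum changes only
      through what \<open>\<pi>\<close> puts at \<open>{q..<a}\<close>; the total over both factors
      is preserved.\<close>
    have "sum u (\<pi> ` {q..<a}) < sum u {q..<a}"
    proof (rule sum_image_exchange_less[of "{q..a + q}"])
      show "\<pi> ` {q..<a} \<subseteq> {q..a + q}"
        using image_mono[of "{q..<a}" "{q..a + q}" \<pi>] permutes_image[OF perm] by auto
      show "card (\<pi> ` {q..<a}) = card {q..<a}"
        using inj by (simp add: card_image inj_on_subset)
      fix x y assume x: "x \<in> {q..<a}" and y: "y \<in> {q..a + q} - {q..<a}"
      have "u y \<le> g q"
        using y q strict_mono_on_leD[OF g(1), of "y - a" q] by (auto simp: u_def)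
      also have "\<dots> < f q" by (rule q)
      also have "\<dots> \<le> u x"
        using x q strict_mono_on_leD[OF f(1), of q x] by (auto simp: u_def)
      finally show "u y < u x" .
    qed (use q ne in auto)
    moreover have "sum (F \<pi>) {q..<a} = sum u (\<pi> ` {q..<a})"
      using inj by (simp add: F_def sum.reindex inj_on_subset)
    moreover have "sum u {q..<a} = sum f {q..<a}"
      by (simp add: u_def)
    moreover have "sum (F \<pi>) {..<q} = sum f {..<q}"
      using q permutes_not_in[OF perm] by (simp add: F_def u_def)
    ultimately have less: "sum (F \<pi>) {..<a} < sum f {..<a}"
      unfolding split by (subst (1 2) sum.union_disjoint) auto
    have add: "(\<Sum>m<a + a. h m) = (\<Sum>i<a. h i) + (\<Sum>i<a. h (a + i))" for h :: "nat \<Rightarrow> nat"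
      by (simp add: lessThan_atLeast0 sum.atLeastLessThan_concat[symmetric, of 0 a "a + a"]
          sum.shift_bounds_nat_ivl[of h 0 a a, simplified] add.commute)
    have "sum (F \<pi>) {..<a} + sum (G \<pi>) {..<a} = (\<Sum>m<a + a. u (\<pi> m))"
      by (simp add: add F_def G_def)
    also have "\<dots> = (\<Sum>m<a + a. u m)"
      using sum.permute[OF full, of \<pi> u] \<pi> by (simp add: Q_def o_def)
    also have "\<dots> = sum f {..<a} + sum g {..<a}"
      by (simp add: add u_def)
    finally show "(sum f {..<a})\<^sup>2 + (sum g {..<a})\<^sup>2 < (sum (F \<pi>) {..<a})\<^sup>2 + (sum (G \<pi>) {..<a})\<^sup>2"
      using square_sum_spread less le by metis
  next
    fix X :: "nat \<Rightarrow> nat \<Rightarrow> complex"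
    let ?t = "\<lambda>\<pi>. of_int (sign \<pi>) * (minor a (F \<pi>) X * minor a (G \<pi>) X)"
    have fg: "minor a u X = minor a f X" "minor a (\<lambda>i. u (a + i)) X = minor a g X"
      by (auto intro: minor_cong simp: u_def)
    have "(\<Sum>\<pi>\<in>K. ?t \<pi>) = (\<Sum>\<pi>\<in>K. minor a f X * minor a g X)"
      using block_permutation_term[OF q(1), of _ u X] unfolding F_def G_def fg
      by (intro sum.cong) (auto simp: K_def)
    moreover have "(\<Sum>\<pi>\<in>K. ?t \<pi>) + (\<Sum>\<pi>\<in>Q. ?t \<pi>) = 0"
    proof -
      have "(\<Sum>\<pi>\<in>K. ?t \<pi>) + (\<Sum>\<pi>\<in>Q. ?t \<pi>) = (\<Sum>\<pi>\<in>?P. ?t \<pi>)"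
        unfolding Q_def using finP by (intro sum.subset_diff[symmetric, THEN trans[OF add.commute]]) (auto simp: K_def)
      then show ?thesis
        using garnir_relation[OF q(1), of u X] by (simp add: F_def G_def)
    qed
    ultimately have "of_nat (card K) * (minor a f X * minor a g X) = - (\<Sum>\<pi>\<in>Q. ?t \<pi>)"
      by (simp add: eq_neg_iff_add_eq_0)
    then have "minor a f X * minor a g X = - (1 / of_nat (card K)) * (\<Sum>\<pi>\<in>Q. ?t \<pi>)"
      using K0 by (simp add: field_simps)
    then show "minor a f X * minor a g X =
        (\<Sum>\<pi>\<in>Q. - (1 / of_nat (card K)) * of_int (sign \<pi>) * (minor a (F \<pi>) X * minor a (G \<pi>) X))"
      by (simp only: sum_distrib_left mult.assoc)
  qed
qed

section \<open>Spans of finite families of functions, and the straightening algorithm\<close>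

definition fun_span :: "'i set \<Rightarrow> ('i \<Rightarrow> 'x \<Rightarrow> complex) \<Rightarrow> ('x \<Rightarrow> complex) set" where
  "fun_span S m = {f. \<exists>d. \<forall>x. f x = (\<Sum>T\<in>S. d T * m T x)}"

lemma fun_span_base:
  assumes "finite S" "T \<in> S"
  shows "m T \<in> fun_span S m"
  unfolding fun_span_def using assms
  by (auto intro!: exI[of _ "\<lambda>U. if U = T then 1 else 0"] simp: if_distrib[of "\<lambda>x. x * _"] cong: if_cong)

lemma fun_span_sum:
  assumes "\<And>i. i \<in> I \<Longrightarrow> F i \<in> fun_span S m"
  shows "(\<lambda>x. \<Sum>i\<in>I. d i * F i x) \<in> fun_span S m"
proof -
  obtain E where E: "\<And>i x. i \<in> I \<Longrightarrow> F i x = (\<Sum>T\<in>S. E i T * m T x)"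
    using assms unfolding fun_span_def mem_Collect_eq by metis
  have "(\<Sum>i\<in>I. d i * F i x) = (\<Sum>T\<in>S. (\<Sum>i\<in>I. d i * E i T) * m T x)" for x
  proof -
    have "(\<Sum>i\<in>I. d i * F i x) = (\<Sum>i\<in>I. \<Sum>T\<in>S. d i * E i T * m T x)"
      by (simp add: E sum_distrib_left mult.assoc)
    also have "\<dots> = (\<Sum>T\<in>S. \<Sum>i\<in>I. d i * E i T * m T x)"
      by (rule sum.swap)
    finally show ?thesis
      by (simp add: sum_distrib_right)
  qed
  then show ?thesis
    unfolding fun_span_def mem_Collect_eq by (intro exI allI)
qed

lemma fun_span_scale:
  assumes "f \<in> fun_span S m"
  shows "(\<lambda>x. d * f x) \<in> fun_span S m"
  using fun_span_sum[of "{()}" "\<lambda>_. f" S m "\<lambda>_. d"] assms by simp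

lemma fun_span_0: "(\<lambda>_. 0) \<in> fun_span S m"
  using fun_span_sum[of "{}"] by simp

definition minor_product :: "nat \<Rightarrow> (nat \<Rightarrow> nat) multiset \<Rightarrow> (nat \<Rightarrow> nat \<Rightarrow> 'a::comm_ring_1) \<Rightarrow> 'a" where
  "minor_product a N X = (\<Prod>f\<in>#N. minor a f X)"

text \<open>This is the standardness condition: strictly increasing, pairwise comparable row
  functions, arranged as a chain, are the columns of a semistandard tableau.\<close>

definition comparable_rows :: "nat \<Rightarrow> (nat \<Rightarrow> nat) multiset \<Rightarrow> bool" where
  "comparable_rows a N \<longleftrightarrow>
    (\<forall>f\<in>#N. \<forall>g\<in>#N. (\<forall>i<a. f i \<le> g i) \<or> (\<forall>i<a. g i \<le> f i))"

text \<open>Induction on \<open>B - energy N\<close>: minors with repeated rows vanish, the others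
  are sorted at the cost of a sign, and an incomparable pair is replaced by products of larger
  energy. Leaving the span abstract separates straightening from plane partitions.\<close>

theorem standard_products_span:
  assumes standard: "\<And>N. size N = c \<Longrightarrow> (\<And>f. f \<in># N \<Longrightarrow> strict_mono_on {..<a} f) \<Longrightarrow>
      (\<And>f i. f \<in># N \<Longrightarrow> i < a \<Longrightarrow> f i < n) \<Longrightarrow> comparable_rows a N \<Longrightarrow>
      minor_product a N \<in> fun_span S m"
    and "size N = c" and "\<And>f i. f \<in># N \<Longrightarrow> i < a \<Longrightarrow> f i < n"
  shows "minor_product a N \<in> fun_span S m"
proof -
  define energy :: "(nat \<Rightarrow> nat) multiset \<Rightarrow> nat"
    where "energy N = (\<Sum>f\<in>#N. (sum f {..<a})\<^sup>2)" for N
  \<comment> \<open>Each of the \<open>c\<close> row sums is at most \<open>a * n\<close>; this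
    bounds the energy, so it cannot grow forever.\<close>
  define B where "B = c * (a * n)\<^sup>2"
  have bound: "energy N \<le> B" if "size N = c" "\<And>f i. f \<in># N \<Longrightarrow> i < a \<Longrightarrow> f i < n" for N
  proof -
    have "energy N \<le> size N * (a * n)\<^sup>2"
      using that(2)
    proof (induction N)
      case (add f N)
      have "sum f {..<a} \<le> a * n"
        using sum_bounded_above[of "{..<a}" f n] add.prems by (simp add: less_imp_le)
      then have "(sum f {..<a})\<^sup>2 \<le> (a * n)\<^sup>2"
        by (rule power_mono) simp
      moreover have "energy N \<le> size N * (a * n)\<^sup>2"
        using add by simp
      ultimately have "(sum f {..<a})\<^sup>2 + energy N \<le> (a * n)\<^sup>2 + size N * (a * n)\<^sup>2"
        by (rule add_mono)
      then show ?case
        by (simp only: energy_def image_mset_add_mset sum_mset.add_mset size_add_mset mult_Suc)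
    qed (simp add: energy_def)
    then show ?thesis
      using that(1) by (simp add: B_def)
  qed
  show ?thesis
    using assms(2,3)
  proof (induction "B - energy N" arbitrary: N rule: less_induct)
    case less
    show ?case
    proof (cases "\<forall>f\<in>#N. inj_on f {..<a}")
      case False
      then obtain f where "f \<in># N" "\<not> inj_on f {..<a}" by auto
      then have "minor_product a N = (\<lambda>X. 0 :: complex)"
        using minor_eq_0[of f a] by (auto simp: minor_product_def fun_eq_iff prod_mset_zero_iff
            intro!: image_eqI[of _ _ f])
      then show ?thesis
        by (simp add: fun_span_0)
    next
      case True
      then have "\<forall>f. \<exists>\<pi>. f \<in># N \<longrightarrow> \<pi> permutes {..<a} \<and> strict_mono_on {..<a} (f \<circ> \<pi>)"
        using exists_sorting_permutation by metis
      then obtain \<rho> where \<rho>: "\<And>f. f \<in># N \<Longrightarrow> \<rho> f permutes {..<a}"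
        "\<And>f. f \<in># N \<Longrightarrow> strict_mono_on {..<a} (f \<circ> \<rho> f)"
        by metis
      define N' where "N' = image_mset (\<lambda>f. f \<circ> \<rho> f) N"
      have size': "size N' = c"
        by (simp add: N'_def less.prems)
      have bd': "f i < n" if "f \<in># N'" "i < a" for f i
      proof -
        obtain g where g: "g \<in># N" "f = g \<circ> \<rho> g"
          using \<open>f \<in># N'\<close> by (auto simp: N'_def)
        then have "\<rho> g i < a"
          using permutes_in_image[OF \<rho>(1)[OF g(1)], of i] \<open>i < a\<close> by simp
        then show ?thesis
          using less.prems(2)[OF g(1)] g(2) by simp
      qed
      have mono': "strict_mono_on {..<a} f" if "f \<in># N'" for f
        using that \<rho> by (auto simp: N'_def)
      have energy': "energy N' = energy N"
        unfolding energy_def N'_def image_mset.compositionality o_def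
        using \<rho> by (intro arg_cong[where f = sum_mset] image_mset_cong)
          (simp add: sum.permute[symmetric, unfolded o_def])
      have "minor_product a N' \<in> fun_span S m"
      proof (cases "comparable_rows a N'")
        case True
        then show ?thesis
          using standard size' bd' mono' by blast
      next
        case False
        \<comment> \<open>Incomparable factors violate the order in both directions, so the one with
          the smaller row sum can be taken as \<open>f\<close> and a suitable \<open>q\<close> still
          exists.\<close>
        have "\<exists>f g. f \<in># N' \<and> g \<in># N' \<and> sum f {..<a} \<le> sum g {..<a} \<and> (\<exists>q<a. g q < f q)"
        proof -
          obtain f g p q where "f \<in># N'" "g \<in># N'" "p < a" "q < a" "g p < f p" "f q < g q"
            using False by (auto simp: comparable_rows_def not_le)
          then show ?thesis
            by (cases "sum f {..<a} \<le> sum g {..<a}") (auto simp: not_le intro: less_imp_le)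
        qed
        then obtain f g q where fg: "f \<in># N'" "g \<in># N'" "sum f {..<a} \<le> sum g {..<a}"
          "q < a" "g q < f q"
          by blast
        obtain R where R: "N' = add_mset f (add_mset g R)"
        proof -
          have "g \<in># N' - {#f#}"
            using fg by (auto simp: in_diff_count)
          then show ?thesis
            using that fg(1) by (metis insert_DiffM)
        qed
        obtain Q :: "(nat \<Rightarrow> nat) set" and d :: complex and F G where Q: "finite Q"
          "\<And>\<pi> i. \<pi> \<in> Q \<Longrightarrow> i < a \<Longrightarrow> F \<pi> i < n \<and> G \<pi> i < n"
          "\<And>\<pi>. \<pi> \<in> Q \<Longrightarrow> (sum f {..<a})\<^sup>2 + (sum g {..<a})\<^sup>2 < (sum (F \<pi>) {..<a})\<^sup>2 + (sum (G \<pi>) {..<a})\<^sup>2"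
          "\<And>X :: nat \<Rightarrow> nat \<Rightarrow> complex. minor a f X * minor a g X =
            (\<Sum>\<pi>\<in>Q. d * of_int (sign \<pi>) * (minor a (F \<pi>) X * minor a (G \<pi>) X))"
        proof (rule minor_product_straighten[OF mono'[OF fg(1)] _ mono'[OF fg(2)] _ fg(3-5), of n], goal_cases)
          case (3 Q d F G)
          show thesis by (rule that[of Q F G d]) (fact 3)+
        qed (use bd' fg in blast)+
        define M where "M \<pi> = add_mset (F \<pi>) (add_mset (G \<pi>) R)" for \<pi>
        have "minor_product a (M \<pi>) \<in> fun_span S m" if "\<pi> \<in> Q" for \<pi>
        proof (rule less.hyps)
          show szM: "size (M \<pi>) = c"
            using size' by (simp add: M_def R)
          show bdM: "h i < n" if "h \<in># M \<pi>" "i < a" for h i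
            using that bd' Q(2)[OF \<open>\<pi> \<in> Q\<close>] by (auto simp: M_def R)
          have "energy N' < energy (M \<pi>)"
            using Q(3)[OF that] by (simp add: energy_def M_def R)
          moreover have "energy (M \<pi>) \<le> B"
            by (rule bound[OF szM]) (rule bdM)
          ultimately show "B - energy (M \<pi>) < B - energy N"
            using energy' by simp
        qed
        then have "(\<lambda>X. \<Sum>\<pi>\<in>Q. d * of_int (sign \<pi>) * minor_product a (M \<pi>) X) \<in> fun_span S m"
          by (rule fun_span_sum)
        moreover have "minor_product a N' = (\<lambda>X. \<Sum>\<pi>\<in>Q. d * of_int (sign \<pi>) * minor_product a (M \<pi>) X)"
        proof
          fix X :: "nat \<Rightarrow> nat \<Rightarrow> complex"
          have "minor_product a N' X = (minor a f X * minor a g X) * minor_product a R X"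
            by (simp add: minor_product_def R mult.assoc)
          then show "minor_product a N' X = (\<Sum>\<pi>\<in>Q. d * of_int (sign \<pi>) * minor_product a (M \<pi>) X)"
            by (simp add: Q(4) sum_distrib_right M_def minor_product_def mult.assoc)
        qed
        ultimately show ?thesis
          by simp
      qed
      then have "(\<lambda>X. of_int (\<Prod>f\<in>#N. sign (\<rho> f)) * minor_product a N' X) \<in> fun_span S m"
        by (rule fun_span_scale)
      moreover have "minor_product a N =
          (\<lambda>X. of_int (\<Prod>f\<in>#N. sign (\<rho> f)) * minor_product a N' X :: complex)"
      proof
        fix X :: "nat \<Rightarrow> nat \<Rightarrow> complex"
        \<comment> \<open>\<open>\<rho>\<close> is controlled only on \<open>N\<close>, so the
          induction that collects the signs runs over submultisets of \<open>N\<close>.\<close>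
        have "minor_product a M X = of_int (\<Prod>f\<in>#M. sign (\<rho> f)) * minor_product a (image_mset (\<lambda>f. f \<circ> \<rho> f) M) X"
          if "M \<subseteq># N" for M
          using that
        proof (induction M)
          case (add f M)
          then have "f \<in># N" "M \<subseteq># N"
            by (auto dest: mset_subset_eq_insertD subset_mset.less_imp_le)
          moreover from \<open>f \<in># N\<close> have "minor a f X = of_int (sign (\<rho> f)) * minor a (f \<circ> \<rho> f) X"
            by (cases "\<rho> f" rule: sign_cases) (simp_all add: minor_permute \<rho>(1))
          ultimately show ?case
            using add.IH by (simp add: minor_product_def algebra_simps o_def)
        qed (simp add: minor_product_def)
        then show "minor_product a N X = of_int (\<Prod>f\<in>#N. sign (\<rho> f)) * minor_product a N' X"
          by (simp add: N'_def)
      qed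
      ultimately show ?thesis
        by simp
    qed
  qed
qed

section \<open>Leading terms\<close>

text \<open>The left side is a base-\<open>B\<close> numeral with digits 0 and 1 in places below
  \<open>N\<close>.\<close>

lemma sum_powers_less:
  fixes B :: nat
  assumes "2 \<le> B" "S \<subseteq> {..<N}"
  shows "(\<Sum>s\<in>S. B ^ s) < B ^ N"
proof -
  have "(\<Sum>s<N. B ^ s) < B ^ N"
  proof (induction N)
    case (Suc N)
    then have "(\<Sum>s<Suc N. B ^ s) < B ^ N + B ^ N" by simp
    also have "\<dots> \<le> B ^ Suc N"
      unfolding power_Suc mult_2[symmetric] using assms(1) by (rule mult_right_mono) simp
    finally show ?case .
  qed simp
  moreover have "(\<Sum>s\<in>S. B ^ s) \<le> (\<Sum>s<N. B ^ s)"
    using assms(2) by (intro sum_mono2) auto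
  ultimately show ?thesis by simp
qed

text \<open>The lowest digit is the residue modulo \<open>B\<close>; remove it and continue by
  induction.\<close>

lemma sum_digits_inj:
  fixes B :: nat
  assumes "(\<Sum>d<N. m d * B ^ d) = (\<Sum>d<N. m' d * B ^ d)"
    and "\<And>d. d < N \<Longrightarrow> m d < B" "\<And>d. d < N \<Longrightarrow> m' d < B" and "d < N"
  shows "m d = m' d"
  using assms
proof (induction N arbitrary: m m' d)
  case (Suc N)
  have shift: "(\<Sum>d<Suc N. m d * B ^ d) = m 0 + B * (\<Sum>d<N. m (Suc d) * B ^ d)" for m
    by (subst sum.lessThan_Suc_shift) (simp add: sum_distrib_left mult_ac)
  have eq: "m 0 + B * (\<Sum>d<N. m (Suc d) * B ^ d) = m' 0 + B * (\<Sum>d<N. m' (Suc d) * B ^ d)"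
    using Suc.prems(1) unfolding shift .
  have "m 0 < B" "m' 0 < B"
    using Suc.prems by auto
  then have m0: "m 0 = m' 0"
    using arg_cong[OF eq, of "\<lambda>x. x mod B"] by simp
  then have "(\<Sum>d<N. m (Suc d) * B ^ d) = (\<Sum>d<N. m' (Suc d) * B ^ d)"
    using eq \<open>m 0 < B\<close> by simp
  then have "m (Suc d) = m' (Suc d)" if "d < N" for d
    using Suc.IH[of "\<lambda>d. m (Suc d)" "\<lambda>d. m' (Suc d)" d] Suc.prems that by auto
  then show ?case
    using m0 Suc.prems(4) by (cases d) auto
qed simp

text \<open>The largest moved point \<open>m\<close> satisfies \<open>\<sigma> m < m\<close>. Terms
  beyond \<open>m\<close> agree. Those up to \<open>m\<close> are distinct powers below
  \<open>B ^ (f m * a + m)\<close>, because \<open>f\<close> increases, so their sum stays below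
  this single diagonal power.\<close>

lemma diagonal_weight_less:
  fixes B :: nat
  assumes B: "2 \<le> B" and f: "strict_mono_on {..<a} f" and \<sigma>: "\<sigma> permutes {..<a}" "\<sigma> \<noteq> id"
  shows "(\<Sum>i<a. B ^ (f i * a + \<sigma> i)) < (\<Sum>i<a. B ^ (f i * a + i))"
proof -
  let ?M = "{i. \<sigma> i \<noteq> i}"
  have "?M \<subseteq> {..<a}"
    using \<sigma>(1) permutes_not_in by fastforce
  then have fin: "finite ?M"
    by (rule finite_subset) simp
  have ne: "?M \<noteq> {}"
    using \<sigma>(2) by auto
  define m where "m = Max ?M"
  have m: "\<sigma> m \<noteq> m" "m < a" and fix_above: "\<And>i. m < i \<Longrightarrow> \<sigma> i = i"
    using Max_in[OF fin ne] Max_ge[OF fin] \<open>?M \<subseteq> {..<a}\<close> by (auto simp: m_def not_less[symmetric])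
  have \<sigma>a: "\<sigma> i < a" if "i < a" for i
    using permutes_in_image[OF \<sigma>(1), of i] that by simp
  have "\<sigma> m < m"
  proof (rule ccontr)
    assume "\<not> \<sigma> m < m"
    then have "\<sigma> (\<sigma> m) = \<sigma> m" using m fix_above by auto
    then show False using m(1) permutes_inj[OF \<sigma>(1)] by (auto dest: injD)
  qed
  \<comment> \<open>The exponents are distinct because their residues modulo \<open>a\<close>
    recover \<open>\<sigma> i\<close>.\<close>
  have inj: "inj_on (\<lambda>i. f i * a + \<sigma> i) {..m}"
  proof (rule inj_onI)
    fix i j assume ij: "i \<in> {..m}" "j \<in> {..m}" "f i * a + \<sigma> i = f j * a + \<sigma> j"
    have "\<sigma> i = (f i * a + \<sigma> i) mod a" using ij(1) m \<sigma>a[of i] by simp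
    also have "\<dots> = (f j * a + \<sigma> j) mod a" using ij by simp
    also have "\<dots> = \<sigma> j" using ij(2) m \<sigma>a[of j] by simp
    finally have "\<sigma> i = \<sigma> j" .
    then show "i = j" using permutes_inj[OF \<sigma>(1)] by (auto dest: injD)
  qed
  have low: "f i * a + \<sigma> i < f m * a + m" if "i \<le> m" for i
  proof (cases "i = m")
    case False
    then have "f i < f m"
      using that m f by (auto simp: strict_mono_on_def)
    then have "Suc (f i) * a \<le> f m * a"
      by (intro mult_right_mono) auto
    then show ?thesis
      using \<sigma>a[of i] that m by simp
  qed (use \<open>\<sigma> m < m\<close> in simp)
  have "(\<Sum>i\<le>m. B ^ (f i * a + \<sigma> i)) = (\<Sum>s\<in>(\<lambda>i. f i * a + \<sigma> i) ` {..m}. B ^ s)"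
    using inj by (simp add: sum.reindex)
  also have "\<dots> < B ^ (f m * a + m)"
    by (rule sum_powers_less[OF B]) (use low in auto)
  also have "\<dots> \<le> (\<Sum>i\<le>m. B ^ (f i * a + i))"
    by (rule member_le_sum) auto
  finally have "(\<Sum>i\<le>m. B ^ (f i * a + \<sigma> i)) < (\<Sum>i\<le>m. B ^ (f i * a + i))" .
  moreover have "(\<Sum>i\<in>{m<..<a}. B ^ (f i * a + \<sigma> i)) = (\<Sum>i\<in>{m<..<a}. B ^ (f i * a + i))"
    using fix_above by (intro sum.cong) auto
  moreover have "(\<Sum>i<a. h i) = (\<Sum>i\<le>m. h i) + (\<Sum>i\<in>{m<..<a}. h i)" for h :: "nat \<Rightarrow> nat"
  proof -
    have split: "{..<a} = {..m} \<union> {m<..<a}" using m(2) by auto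
    show ?thesis unfolding split by (rule sum.union_disjoint) auto
  qed
  ultimately show ?thesis
    by simp
qed

text \<open>With entries \<open>z ^ (B ^ (r * a + j))\<close> the diagonal term of each minor dominates, and the degree of a
  product of at most \<open>B - 1\<close> minors records, in base \<open>B\<close>, the multiset of all diagonal positions.\<close>

lemma minor_monic:
  fixes B :: nat
  assumes B: "2 \<le> B" and f: "strict_mono_on {..<a} f"
  defines "p \<equiv> minor a f (\<lambda>r j. monom (1 :: complex) (B ^ (r * a + j)))"
  shows "degree p = (\<Sum>i<a. B ^ (f i * a + i))" and "lead_coeff p = 1"
proof -
  let ?E = "\<Sum>i<a. B ^ (f i * a + i)" and ?S = "{\<sigma>. \<sigma> permutes {..<a}}"
  have prod: "(\<Prod>i<a. monom (1 :: complex) (B ^ (f i * a + \<sigma> i))) = monom 1 (\<Sum>i<a. B ^ (f i * a + \<sigma> i))" for \<sigma>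
    by (simp add: monom_altdef power_sum)
  have id: "id \<in> ?S"
    by (simp add: permutes_id)
  have "p = monom 1 ?E + (\<Sum>\<sigma>\<in>?S - {id}. of_int (sign \<sigma>) * monom 1 (\<Sum>i<a. B ^ (f i * a + \<sigma> i)))"
    unfolding p_def minor_def prod by (subst sum.remove[OF _ id]) (simp_all add: finite_permutations)
  then have coeff: "coeff p k = coeff (monom 1 ?E) k +
      (\<Sum>\<sigma>\<in>?S - {id}. coeff (of_int (sign \<sigma>) * monom 1 (\<Sum>i<a. B ^ (f i * a + \<sigma> i))) k)" for k
    by (simp add: coeff_sum)
  have other: "coeff (of_int (sign \<sigma>) * monom (1 :: complex) (\<Sum>i<a. B ^ (f i * a + \<sigma> i))) k = 0"
    if "\<sigma> \<in> ?S - {id}" "?E \<le> k" for \<sigma> k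
    using diagonal_weight_less[OF B f, of \<sigma>] that by (cases \<sigma> rule: sign_cases) auto
  have top: "coeff p ?E = 1"
    unfolding coeff using other[of _ ?E] by simp
  moreover have "coeff p k = 0" if "?E < k" for k
    unfolding coeff using other[of _ k] that by simp
  ultimately show deg: "degree p = ?E"
    by (intro antisym degree_le le_degree) auto
  show "lead_coeff p = 1"
    unfolding deg by (rule top)
qed

lemma poly_minor:
  "poly (minor a f X) z = minor a f (\<lambda>r j. poly (X r j) z)" for X :: "nat \<Rightarrow> nat \<Rightarrow> 'a::idom poly"
  by (simp add: minor_def poly_sum poly_prod)

text \<open>Among the terms with nonzero coefficient exactly one has maximal degree, and nothing
  cancels its leading coefficient.\<close>

lemma distinct_degrees_independent:
  fixes q :: "'i \<Rightarrow> complex poly"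
  assumes "finite S" and inj: "inj_on (\<lambda>T. degree (q T)) S" and nz: "\<And>T. T \<in> S \<Longrightarrow> q T \<noteq> 0"
    and sum: "(\<Sum>T\<in>S. smult (d T) (q T)) = 0" and "T \<in> S"
  shows "d T = 0"
proof (rule ccontr)
  assume "d T \<noteq> 0"
  define S' where "S' = {T \<in> S. d T \<noteq> 0}"
  have fin: "finite S'" and "S' \<noteq> {}"
    using assms(1,5) \<open>d T \<noteq> 0\<close> by (auto simp: S'_def)
  have "Max ((\<lambda>T. degree (q T)) ` S') \<in> (\<lambda>T. degree (q T)) ` S'"
    by (rule Max_in) (use fin \<open>S' \<noteq> {}\<close> in auto)
  then obtain U where "U \<in> S'" "Max ((\<lambda>T. degree (q T)) ` S') = degree (q U)"
    by auto
  then have U: "U \<in> S'" "\<And>T. T \<in> S' \<Longrightarrow> degree (q T) \<le> degree (q U)"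
    using Max_ge[of "(\<lambda>T. degree (q T)) ` S'"] fin by auto
  have "0 = coeff (\<Sum>T\<in>S. smult (d T) (q T)) (degree (q U))"
    using sum by simp
  also have "\<dots> = (\<Sum>T\<in>S. if T = U then d U * lead_coeff (q U) else 0)"
    unfolding coeff_sum
  proof (intro sum.cong refl)
    fix T assume "T \<in> S"
    show "coeff (smult (d T) (q T)) (degree (q U)) = (if T = U then d U * lead_coeff (q U) else 0)"
    proof (cases "T = U \<or> d T = 0")
      case False
      then have "degree (q T) < degree (q U)"
        using U inj \<open>T \<in> S\<close> by (auto simp: S'_def inj_on_def le_less)
      then show ?thesis
        using False by (simp add: coeff_eq_0)
    qed auto
  qed
  also have "\<dots> = d U * lead_coeff (q U)"
    using U(1) assms(1) by (simp add: S'_def)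
  finally show False
    using U(1) nz by (auto simp: S'_def)
qed

section \<open>Standard products and plane partitions\<close>

definition row_length :: "(nat \<times> nat \<times> nat) set \<Rightarrow> nat \<Rightarrow> nat \<Rightarrow> nat" where
  "row_length T i k = card {j. (i, j, k) \<in> T}"

text \<open>The shift by \<open>t\<close> turns the weakly increasing sequence of row lengths, read from the last row of the layer
  to the first, into a strictly increasing one.\<close>

definition layer_rows :: "nat \<Rightarrow> (nat \<times> nat \<times> nat) set \<Rightarrow> nat \<Rightarrow> nat \<Rightarrow> nat" where
  "layer_rows a T k t = row_length T (a - t) k + t"

definition pp_product :: "nat \<Rightarrow> nat \<Rightarrow> (nat \<times> nat \<times> nat) set \<Rightarrow> (nat \<Rightarrow> nat \<Rightarrow> 'a::comm_ring_1) \<Rightarrow> 'a" where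
  "pp_product a c T X = (\<Prod>k\<in>{1..c}. minor a (layer_rows a T k) X)"

section \<open>Row lengths, heights and complements of plane partitions\<close>

lemma downset_eq_atLeastAtMost:
  fixes J :: "nat set"
  assumes "finite J" and pos: "\<And>j. j \<in> J \<Longrightarrow> 1 \<le> j"
    and down: "\<And>j j'. j \<in> J \<Longrightarrow> 1 \<le> j' \<Longrightarrow> j' \<le> j \<Longrightarrow> j' \<in> J"
  shows "J = {1..card J}"
proof (cases "J = {}")
  case False
  have "J = {1..Max J}"
  proof (intro equalityI subsetI)
    fix j assume "j \<in> J"
    then show "j \<in> {1..Max J}"
      using pos assms(1) by simp
  next
    fix j assume "j \<in> {1..Max J}"
    then show "j \<in> J"
      using down[OF Max_in[OF assms(1) False], of j] by simp
  qed
  then obtain m where "J = {1..m}" ..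
  then show ?thesis
    by simp
qed simp

lemma finite_plane_partitions: "finite (plane_partitions a b c)"
  by (rule finite_subset[of _ "Pow (pp_box a b c)"]) (auto simp: plane_partitions_def pp_box_def)

context
  fixes a b c :: nat and T
  assumes T: "T \<in> plane_partitions a b c"
begin

lemma pp_in_box: "(i, j, k) \<in> T \<Longrightarrow> 1 \<le> i \<and> i \<le> a \<and> 1 \<le> j \<and> j \<le> b \<and> 1 \<le> k \<and> k \<le> c"
  using T by (auto simp: plane_partitions_def pp_box_def)

lemma pp_down:
  "(i, j, k) \<in> T \<Longrightarrow> 1 \<le> i' \<Longrightarrow> i' \<le> i \<Longrightarrow> 1 \<le> j' \<Longrightarrow> j' \<le> j \<Longrightarrow> 1 \<le> k' \<Longrightarrow> k' \<le> k \<Longrightarrow> (i', j', k') \<in> T"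
  using T unfolding plane_partitions_def by blast

lemma finite_pp_row: "finite {j. (i, j, k) \<in> T}"
  by (rule finite_subset[of _ "{1..b}"]) (auto dest: pp_in_box)

lemma row_length_le: "row_length T i k \<le> b"
proof -
  have "{j. (i, j, k) \<in> T} \<subseteq> {1..b}"
    by (auto dest: pp_in_box)
  then show ?thesis
    unfolding row_length_def using card_mono[of "{1..b}"] by fastforce
qed

lemma pp_row_eq: "{j. (i, j, k) \<in> T} = {1..row_length T i k}"
  unfolding row_length_def
proof (rule downset_eq_atLeastAtMost[OF finite_pp_row])
  fix j j' assume *: "j \<in> {j. (i, j, k) \<in> T}" "1 \<le> j'" "j' \<le> j"
  then have "(i, j, k) \<in> T" by simp
  then have "(i, j', k) \<in> T"
    by (rule pp_down) (use * pp_in_box[OF \<open>(i, j, k) \<in> T\<close>] in auto)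
  then show "j' \<in> {j. (i, j, k) \<in> T}" by simp
next
  fix j assume "j \<in> {j. (i, j, k) \<in> T}"
  then show "1 \<le> j" using pp_in_box[of i j k] by simp
qed

lemma mem_pp_iff_row_length: "(i, j, k) \<in> T \<longleftrightarrow> 1 \<le> j \<and> j \<le> row_length T i k"
proof -
  have "j \<in> {j. (i, j, k) \<in> T} \<longleftrightarrow> j \<in> {1..row_length T i k}"
    by (rule arg_cong[OF pp_row_eq])
  then show ?thesis by simp
qed

text \<open>Columns in the third direction are initial segments too; \<open>pp_weight_inj\<close>
  recovers a plane partition from their heights.\<close>

lemma mem_pp_iff_height: "(i, j, k) \<in> T \<longleftrightarrow> 1 \<le> k \<and> k \<le> card {k. (i, j, k) \<in> T}"
proof -
  have "finite {k. (i, j, k) \<in> T}"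
    by (rule finite_subset[of _ "{1..c}"]) (auto dest: pp_in_box)
  then have "{k. (i, j, k) \<in> T} = {1..card {k. (i, j, k) \<in> T}}"
  proof (rule downset_eq_atLeastAtMost)
    fix k k' assume *: "k \<in> {k. (i, j, k) \<in> T}" "1 \<le> k'" "k' \<le> k"
    then have "(i, j, k) \<in> T" by simp
    then have "(i, j, k') \<in> T"
      by (rule pp_down) (use * pp_in_box[OF \<open>(i, j, k) \<in> T\<close>] in auto)
    then show "k' \<in> {k. (i, j, k) \<in> T}" by simp
  next
    fix k assume "k \<in> {k. (i, j, k) \<in> T}"
    then show "1 \<le> k" using pp_in_box[of i j k] by simp
  qed
  then have "k \<in> {k. (i, j, k) \<in> T} \<longleftrightarrow> k \<in> {1..card {k. (i, j, k) \<in> T}}"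
    by (rule arg_cong)
  then show ?thesis by simp
qed

lemma row_length_antimono: "1 \<le> i \<Longrightarrow> i \<le> i' \<Longrightarrow> row_length T i' k \<le> row_length T i k"
  unfolding row_length_def
  by (rule card_mono[OF finite_pp_row]) (use pp_down[of i' _ k i _ k] pp_in_box[of i' _ k] in auto)

lemma strict_mono_layer_rows: "strict_mono_on {..<a} (layer_rows a T k)"
proof (rule strict_mono_onI)
  fix s t assume st: "s \<in> {..<a}" "t \<in> {..<a}" "s < t"
  have "row_length T (a - s) k \<le> row_length T (a - t) k"
    by (rule row_length_antimono) (use st in auto)
  then show "layer_rows a T k s < layer_rows a T k t"
    using st by (simp add: layer_rows_def)
qed

lemma layer_rows_less: "t < a \<Longrightarrow> layer_rows a T k t < a + b"
  using row_length_le[of "a - t" k] by (simp add: layer_rows_def)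

lemma card_pp: "card T = (\<Sum>k\<in>{1..c}. \<Sum>i\<in>{1..a}. row_length T i k)"
proof -
  have "bij_betw (\<lambda>(k, i, j). (i, j, k)) (SIGMA k:{1..c}. SIGMA i:{1..a}. {j. (i, j, k) \<in> T}) T"
    by (rule bij_betwI[of _ _ _ "\<lambda>(i, j, k). (k, i, j)"]) (auto dest: pp_in_box)
  then have "card T = card (SIGMA k:{1..c}. SIGMA i:{1..a}. {j. (i, j, k) \<in> T})"
    by (simp add: bij_betw_same_card)
  then show ?thesis
    by (simp add: finite_pp_row row_length_def)
qed

text \<open>The shift adds the same constant in every layer, so the sign of the total of all row
  indices is \<open>(-1) ^ card T\<close> up to a factor independent of \<open>T\<close>.\<close>

lemma sum_layer_rows: "(\<Sum>t<a. layer_rows a T k t) = (\<Sum>i\<in>{1..a}. row_length T i k) + (\<Sum>t<a. t)"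
proof -
  have "(\<Sum>t<a. row_length T (a - t) k) = (\<Sum>i\<in>{1..a}. row_length T i k)"
    by (rule sum.reindex_bij_witness[of _ "\<lambda>i. a - i" "\<lambda>t. a - t"]) auto
  then show ?thesis
    by (simp add: layer_rows_def sum.distrib)
qed

lemma pp_complement_mem: "pp_complement a b c T \<in> plane_partitions a b c"
proof -
  have "(i', j', k') \<in> pp_complement a b c T"
    if *: "(i, j, k) \<in> pp_complement a b c T" "1 \<le> i'" "i' \<le> i" "1 \<le> j'" "j' \<le> j" "1 \<le> k'" "k' \<le> k"
    for i j k i' j' k'
  proof -
    have ijk: "i \<le> a" "j \<le> b" "k \<le> c" "(a + 1 - i, b + 1 - j, c + 1 - k) \<notin> T"
      using *(1) by (auto simp: pp_complement_def pp_box_def)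
    have "(a + 1 - i', b + 1 - j', c + 1 - k') \<notin> T"
    proof
      assume "(a + 1 - i', b + 1 - j', c + 1 - k') \<in> T"
      then have "(a + 1 - i, b + 1 - j, c + 1 - k) \<in> T"
        by (rule pp_down) (use * ijk in auto)
      then show False using ijk by simp
    qed
    then show ?thesis
      using * ijk by (auto simp: pp_complement_def pp_box_def)
  qed
  moreover have "pp_complement a b c T \<subseteq> pp_box a b c"
    by (auto simp: pp_complement_def)
  ultimately show ?thesis
    unfolding plane_partitions_def mem_Collect_eq by blast
qed

lemma row_length_pp_complement:
  assumes "i \<in> {1..a}" "k \<in> {1..c}"
  shows "row_length (pp_complement a b c T) i k = b - row_length T (a + 1 - i) (c + 1 - k)"
proof -
  have "{j. (i, j, k) \<in> pp_complement a b c T} = {1..b - row_length T (a + 1 - i) (c + 1 - k)}"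
    using assms row_length_le[of "a + 1 - i" "c + 1 - k"]
    by (auto simp: pp_complement_def pp_box_def mem_pp_iff_row_length)
  then show ?thesis
    by (simp add: row_length_def)
qed

text \<open>The shifts at \<open>t\<close> and \<open>a - 1 - t\<close> add up to
  \<open>a - 1\<close>; this turns the complementary lengths \<open>b - x\<close> into the reversal
  \<open>a + b - 1 - y\<close> of matrix rows.\<close>

lemma layer_rows_pp_complement:
  assumes "t < a" "k \<in> {1..c}"
  shows "layer_rows a (pp_complement a b c T) k t = a + b - 1 - layer_rows a T (c + 1 - k) (a - 1 - t)"
proof -
  have "a - (a - 1 - t) = t + 1" "a + 1 - (a - t) = t + 1"
    using assms by auto
  then show ?thesis
    using assms row_length_le[of "t + 1" "c + 1 - k"]
    by (simp add: layer_rows_def row_length_pp_complement)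
qed

end

section \<open>Chains of row sets as plane partitions\<close>

lemma strict_mono_on_add_le:
  fixes f :: "nat \<Rightarrow> nat"
  assumes "strict_mono_on {..<a} f" "s \<le> t" "t < a"
  shows "f s + (t - s) \<le> f t"
  using assms(2,3)
proof (induction t rule: dec_induct)
  case (step t)
  then have "f t < f (Suc t)"
    using assms(1) by (auto simp: strict_mono_on_def)
  then show ?case
    using step by simp
qed simp

text \<open>Comparable factors ordered by row sum form a chain. Removing the shift from the strictly
  increasing rows leaves the row lengths of nested layers, hence a plane partition whose product is
  the given one.\<close>

lemma standard_product_in_span:
  assumes size: "size N = c" and mono: "\<And>f. f \<in># N \<Longrightarrow> strict_mono_on {..<a} f"
    and bd: "\<And>f i. f \<in># N \<Longrightarrow> i < a \<Longrightarrow> f i < a + b" and comp: "comparable_rows a N"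
  shows "minor_product a N \<in> fun_span (plane_partitions a b c) (pp_product a c)"
proof -
  obtain xs where xs: "mset xs = N"
    using ex_mset by blast
  define L where "L = sort_key (\<lambda>f. sum f {..<a}) xs"
  \<comment> \<open>Layers are numbered from \<open>1\<close> and shrink as \<open>k\<close> grows,
    so the increasing list is read backwards.\<close>
  define F where "F k = L ! (c - k)" for k
  have L: "mset L = N" "sorted (map (\<lambda>f. sum f {..<a}) L)" "length L = c"
    using xs size by (auto simp: L_def)
  have F_mem: "F k \<in># N" if "1 \<le> k" "k \<le> c" for k
    using that L(3) nth_mem[of "c - k" L] unfolding F_def L(1)[symmetric] by simp
  note F_mono = mono[OF F_mem] and F_bd = bd[OF F_mem]
  have chain: "F k' t \<le> F k t" if k: "1 \<le> k" "k \<le> k'" "k' \<le> c" and t: "t < a" for k k' t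
  proof -
    have le: "sum (F k') {..<a} \<le> sum (F k) {..<a}"
      using sorted_nth_mono[OF L(2), of "c - k'" "c - k"] k L(3) by (simp add: F_def)
    consider "\<forall>i<a. F k' i \<le> F k i" | "\<forall>i<a. F k i \<le> F k' i"
      using comp F_mem[of k] F_mem[of k'] k unfolding comparable_rows_def by force
    then show ?thesis
    proof cases
      \<comment> \<open>The factor with the larger entries has no larger row sum, so the two agree
        on \<open>{..<a}\<close>.\<close>
      case 2
      then have "sum (F k) {..<a} = sum (F k') {..<a}"
        using le sum_mono[of "{..<a}" "F k" "F k'"] by force
      then have "F k t = F k' t"
        using 2 t by (intro sum_mono_inv[of "F k" "{..<a}" "F k'"]) auto
      then show ?thesis by simp
    qed (use t in blast)
  qed
  define T where "T = {(i, j, k). 1 \<le> i \<and> i \<le> a \<and> 1 \<le> k \<and> k \<le> c \<and> 1 \<le> j \<and> j + (a - i) \<le> F k (a - i)}"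
  have "T \<in> plane_partitions a b c"
    unfolding plane_partitions_def mem_Collect_eq
  proof (intro conjI allI impI subsetI)
    fix x assume "x \<in> T"
    then obtain i j k where x: "x = (i, j, k)" and ijk: "1 \<le> i" "i \<le> a" "1 \<le> k" "k \<le> c" "1 \<le> j"
      "j + (a - i) \<le> F k (a - i)"
      by (auto simp: T_def)
    \<comment> \<open>Strict growth up to the last entry, which is below \<open>a + b\<close>,
      leaves room only for \<open>j \<le> b\<close>.\<close>
    have "F k (a - i) + (a - 1 - (a - i)) \<le> F k (a - 1)"
      using ijk by (intro strict_mono_on_add_le[OF F_mono[of k]]) auto
    then show "x \<in> pp_box a b c"
      using ijk F_bd[of k "a - 1"] by (auto simp: x pp_box_def)
  next
    fix i j k i' j' k'
    assume *: "(i, j, k) \<in> T \<and> 1 \<le> i' \<and> i' \<le> i \<and> 1 \<le> j' \<and> j' \<le> j \<and> 1 \<le> k' \<and> k' \<le> k"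
    have "F k (a - i) + (a - i' - (a - i)) \<le> F k (a - i')"
      using * by (intro strict_mono_on_add_le[OF F_mono[of k]]) (auto simp: T_def)
    moreover have "F k (a - i') \<le> F k' (a - i')"
      using * by (intro chain) (auto simp: T_def)
    ultimately show "(i', j', k') \<in> T"
      using * by (auto simp: T_def)
  qed
  moreover have "pp_product a c T = (minor_product a N :: _ \<Rightarrow> complex)"
  proof
    fix X :: "nat \<Rightarrow> nat \<Rightarrow> complex"
    have rows: "layer_rows a T k t = F k t" if k: "k \<in> {1..c}" and t: "t < a" for k t
    proof -
      have "t \<le> F k t"
        using strict_mono_on_add_le[OF F_mono[of k], of 0 t] k t by simp
      moreover have "{j. (a - t, j, k) \<in> T} = {1..F k t - t}"
        using k t by (auto simp: T_def)
      ultimately show ?thesis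
        by (simp add: layer_rows_def row_length_def)
    qed
    have "pp_product a c T X = (\<Prod>k\<in>{1..c}. minor a (L ! (c - k)) X)"
      unfolding pp_product_def using rows by (intro prod.cong refl minor_cong) (simp add: F_def)
    also have "\<dots> = (\<Prod>k<c. minor a (L ! k) X)"
      by (rule prod.reindex_bij_witness[of _ "\<lambda>k. c - k" "\<lambda>k. c - k"]) auto
    also have "\<dots> = prod_list (map (\<lambda>f. minor a f X) L)"
      by (simp add: prod.list_conv_set_nth L(3) atLeast0LessThan)
    also have "\<dots> = minor_product a N X"
      by (simp add: minor_product_def L(1)[symmetric] prod_mset_prod_list[symmetric])
    finally show "pp_product a c T X = minor_product a N X" .
  qed
  ultimately show ?thesis
    using fun_span_base[OF finite_plane_partitions, of T a b c "pp_product a c"] by simp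
qed

section \<open>Recovering a plane partition from its leading degree\<close>

lemma sum_power_eq_sum_card:
  fixes B :: nat
  assumes "finite I" "\<And>x. x \<in> I \<Longrightarrow> g x < N"
  shows "(\<Sum>x\<in>I. B ^ g x) = (\<Sum>d<N. card {x \<in> I. g x = d} * B ^ d)"
proof -
  have "g ` I \<subseteq> {..<N}"
    using assms(2) by auto
  then have "(\<Sum>x\<in>I. B ^ g x) = (\<Sum>d<N. \<Sum>x | x \<in> I \<and> g x = d. B ^ g x)"
    by (intro sum.group[symmetric] assms(1) finite_lessThan)
  also have "\<dots> = (\<Sum>d<N. card {x \<in> I. g x = d} * B ^ d)"
    by (intro sum.cong refl) simp
  finally show ?thesis .
qed

text \<open>The degree of \<open>pp_product\<close> under the substitution of
  \<open>minor_monic\<close>. Digits count at most \<open>c\<close> layers, so base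
  \<open>c + 2\<close> avoids carries; it is also at least 2, as \<open>minor_monic\<close>
  requires.\<close>

definition pp_weight :: "nat \<Rightarrow> nat \<Rightarrow> (nat \<times> nat \<times> nat) set \<Rightarrow> nat" where
  "pp_weight a c T = (\<Sum>k\<in>{1..c}. \<Sum>t<a. (c + 2) ^ (layer_rows a T k t * a + t))"

text \<open>Digit \<open>r * a + t\<close> of the weight in base \<open>c + 2\<close> counts the
  layers with entry \<open>r\<close> at place \<open>t\<close>; since \<open>t < a\<close>, the
  position determines the pair.\<close>

lemma layer_rows_card_eq:
  assumes T: "T \<in> plane_partitions a b c" and U: "U \<in> plane_partitions a b c"
    and eq: "pp_weight a c T = pp_weight a c U" and t: "t < a" and r: "r < a + b"
  shows "card {k \<in> {1..c}. layer_rows a T k t = r} = card {k \<in> {1..c}. layer_rows a U k t = r}"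
proof -
  let ?I = "{1..c} \<times> {..<a}" and ?N = "(a + b) * a"
  define g where "g T = (\<lambda>(k, t). layer_rows a T k t * a + t)" for T
  define m where "m T d = card {x \<in> ?I. g T x = d}" for T d
  have fib: "m T (r * a + t) = card {k \<in> {1..c}. layer_rows a T k t = r}" if "t < a" for T r t
  proof -
    have unique: "s = t \<and> k = k'" if "s < a" "k * a + s = k' * a + t" for k k' s
    proof -
      have "s = (k * a + s) mod a"
        using that(1) by simp
      also have "\<dots> = (k' * a + t) mod a"
        by (simp only: that(2))
      also have "\<dots> = t"
        using \<open>t < a\<close> by simp
      finally show ?thesis
        using that by simp
    qed
    have "{x \<in> ?I. g T x = r * a + t} = (\<lambda>k. (k, t)) ` {k \<in> {1..c}. layer_rows a T k t = r}"
    proof (intro equalityI subsetI)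
      fix x assume "x \<in> {x \<in> ?I. g T x = r * a + t}"
      then obtain k s where x: "x = (k, s)" "k \<in> {1..c}" "s < a" "layer_rows a T k s * a + s = r * a + t"
        by (auto simp: g_def)
      then show "x \<in> (\<lambda>k. (k, t)) ` {k \<in> {1..c}. layer_rows a T k t = r}"
        using unique[OF x(3,4)] by simp
    qed (use \<open>t < a\<close> in \<open>auto simp: g_def\<close>)
    then show ?thesis
      by (simp add: m_def card_image inj_on_def)
  qed
  have lt: "r * a + t < ?N" if "r < a + b" "t < a" for r t
  proof -
    have "Suc r * a \<le> ?N"
      using that by (intro mult_right_mono) auto
    then show ?thesis using that by simp
  qed
  have weight: "pp_weight a c T = (\<Sum>d<?N. m T d * (c + 2) ^ d)" if "T \<in> plane_partitions a b c" for T
  proof -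
    have "pp_weight a c T = (\<Sum>x\<in>?I. (c + 2) ^ g T x)"
      by (simp add: pp_weight_def g_def sum.cartesian_product case_prod_unfold)
    also have "\<dots> = (\<Sum>d<?N. m T d * (c + 2) ^ d)"
      unfolding m_def
      by (rule sum_power_eq_sum_card) (use lt layer_rows_less[OF that] in \<open>auto simp: g_def\<close>)
    finally show ?thesis .
  qed
  have small: "m T d < c + 2" if "d < ?N" for T d
  proof -
    have "a > 0" using that by (cases a) auto
    then have "m T (d div a * a + d mod a) = card {k \<in> {1..c}. layer_rows a T k (d mod a) = d div a}"
      by (intro fib) simp
    also have "\<dots> \<le> card {1..c}"
      by (rule card_mono) auto
    finally show ?thesis by simp
  qed
  have "m T (r * a + t) = m U (r * a + t)"
    by (rule sum_digits_inj[of _ "c + 2" ?N])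
      (use weight[OF T] weight[OF U] eq small lt[OF r t] in auto)
  then show ?thesis
    using t by (simp add: fib)
qed

text \<open>The height over \<open>(i, j)\<close> counts the layers whose row \<open>i\<close> has
  length at least \<open>j\<close>, that is, whose entry at \<open>a - i\<close> is at least
  \<open>j + (a - i)\<close>. The digits of the weight give all these counts.\<close>

lemma pp_weight_inj: "inj_on (pp_weight a c) (plane_partitions a b c)"
proof (rule inj_onI)
  fix T U assume T: "T \<in> plane_partitions a b c" and U: "U \<in> plane_partitions a b c"
    and eq: "pp_weight a c T = pp_weight a c U"
  have height: "card {k. (i, j, k) \<in> T} = (\<Sum>r = j + (a - i)..<a + b. card {k \<in> {1..c}. layer_rows a T k (a - i) = r})"
    if T: "T \<in> plane_partitions a b c" and i: "1 \<le> i" "i \<le> a" and j: "1 \<le> j" for T i j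
  proof -
    have "{k. (i, j, k) \<in> T} = (\<Union>r\<in>{j + (a - i)..<a + b}. {k \<in> {1..c}. layer_rows a T k (a - i) = r})"
    proof (intro equalityI subsetI)
      fix k assume "k \<in> {k. (i, j, k) \<in> T}"
      then have "(i, j, k) \<in> T" by simp
      then show "k \<in> (\<Union>r\<in>{j + (a - i)..<a + b}. {k \<in> {1..c}. layer_rows a T k (a - i) = r})"
        using pp_in_box[OF T, of i j k] mem_pp_iff_row_length[OF T, of i j k] i
          layer_rows_less[OF T, of "a - i" k]
        by (auto simp: layer_rows_def)
    next
      fix k assume "k \<in> (\<Union>r\<in>{j + (a - i)..<a + b}. {k \<in> {1..c}. layer_rows a T k (a - i) = r})"
      then show "k \<in> {k. (i, j, k) \<in> T}"
        using mem_pp_iff_row_length[OF T, of i j k] i j by (auto simp: layer_rows_def)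
    qed
    then show ?thesis
      by (simp only:) (rule card_UN_disjoint; auto)
  qed
  have heights_eq: "card {k. (i, j, k) \<in> T} = card {k. (i, j, k) \<in> U}" if "1 \<le> i" "i \<le> a" "1 \<le> j" for i j
    using that unfolding height[OF T that] height[OF U that]
    by (intro sum.cong refl layer_rows_card_eq[OF T U eq]) auto
  have "(i, j, k) \<in> T \<longleftrightarrow> (i, j, k) \<in> U" for i j k
  proof (cases "1 \<le> i \<and> i \<le> a \<and> 1 \<le> j")
    case True
    then show ?thesis
      using mem_pp_iff_height[OF T, of i j k] mem_pp_iff_height[OF U, of i j k] heights_eq by simp
  next
    case False
    then show ?thesis
      using pp_in_box[OF T, of i j k] pp_in_box[OF U, of i j k] by blast
  qed
  then show "T = U" by auto
qed

text \<open>Substituting monomials turns the products into monic polynomials whose degrees are the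
  pairwise distinct weights. A relation valid for all matrices gives a polynomial vanishing at every
  \<open>z\<close>, hence zero.\<close>

theorem pp_products_independent:
  assumes sum: "\<And>X. (\<Sum>T\<in>plane_partitions a b c. d T * pp_product a c T X) = (0 :: complex)"
    and T: "T \<in> plane_partitions a b c"
  shows "d T = 0"
proof -
  let ?S = "plane_partitions a b c"
  define Y where "Y = (\<lambda>r j. monom (1 :: complex) ((c + 2) ^ (r * a + j)))"
  define q where "q T = pp_product a c T Y" for T
  have monic: "lead_coeff (q T) = 1" "degree (q T) = pp_weight a c T" if "T \<in> ?S" for T
  proof -
    have m: "degree (minor a (layer_rows a T k) Y) = (\<Sum>t<a. (c + 2) ^ (layer_rows a T k t * a + t))"
      "lead_coeff (minor a (layer_rows a T k) Y) = 1" for k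
      unfolding Y_def using minor_monic[OF _ strict_mono_layer_rows[OF that], of "c + 2" k] by simp_all
    show "lead_coeff (q T) = 1"
      unfolding q_def pp_product_def lead_coeff_prod using m(2) by simp
    have nz: "minor a (layer_rows a T k) Y \<noteq> 0" for k
      using m(2)[of k] by auto
    have "degree (q T) = (\<Sum>k\<in>{1..c}. degree (minor a (layer_rows a T k) Y))"
      unfolding q_def pp_product_def
      by (rule degree_prod_eq_sum_degree) (use nz in simp)
    then show "degree (q T) = pp_weight a c T"
      by (simp add: m(1) pp_weight_def)
  qed
  have "poly (\<Sum>T\<in>?S. smult (d T) (q T)) z = 0" for z
    using sum[of "\<lambda>r j. poly (Y r j) z"]
    by (simp add: poly_sum q_def pp_product_def poly_prod poly_minor)
  then have "(\<Sum>T\<in>?S. smult (d T) (q T)) = 0"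
    using poly_all_0_iff_0 by blast
  moreover have "inj_on (\<lambda>T. degree (q T)) ?S"
    using pp_weight_inj monic(2) by (simp add: inj_on_def)
  moreover have "q T \<noteq> 0" if "T \<in> ?S" for T
    using monic(1)[OF that] by auto
  ultimately show ?thesis
    using distinct_degrees_independent[OF finite_plane_partitions] T by blast
qed

section \<open>The span of the products under row operations\<close>

theorem pp_products_span:
  assumes "size N = c" and "\<And>f i. f \<in># N \<Longrightarrow> i < a \<Longrightarrow> f i < a + b"
  shows "minor_product a N \<in> fun_span (plane_partitions a b c) (pp_product a c)"
proof (rule standard_products_span[where n = "a + b"])
  show "size N = c" by fact
  show "f i < a + b" if "f \<in># N" "i < a" for f i
    using assms(2) that .
next
  fix M :: "(nat \<Rightarrow> nat) multiset"
  assume "size M = c" "\<And>f. f \<in># M \<Longrightarrow> strict_mono_on {..<a} f"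
    "\<And>f i. f \<in># M \<Longrightarrow> i < a \<Longrightarrow> f i < a + b" "comparable_rows a M"
  then show "minor_product a M \<in> fun_span (plane_partitions a b c) (pp_product a c)"
    by (rule standard_product_in_span)
qed

definition row_action :: "nat \<Rightarrow> (nat \<Rightarrow> nat \<Rightarrow> complex) \<Rightarrow> (nat \<Rightarrow> nat \<Rightarrow> complex) \<Rightarrow> nat \<Rightarrow> nat \<Rightarrow> complex" where
  "row_action n P X = (\<lambda>r j. \<Sum>l<n. P r l * X l j)"

text \<open>\<open>N\<close> holds the factors still to be expanded and \<open>R\<close> those
  already written with rows of \<open>X\<close>; each step moves one factor over by
  \<open>minor_linear_rows\<close>.\<close>

lemma row_action_product_in_span:
  assumes "size N + size R = c" and "\<And>f i. f \<in># R \<Longrightarrow> i < a \<Longrightarrow> f i < a + b"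
  shows "(\<lambda>X. minor_product a N (row_action (a + b) P X) * minor_product a R X)
    \<in> fun_span (plane_partitions a b c) (pp_product a c)"
  using assms
proof (induction N arbitrary: R)
  case empty
  then show ?case
    using pp_products_span[of R c a b] by (simp add: minor_product_def[abs_def])
next
  case (add f N)
  let ?H = "PiE {..<a} (\<lambda>_. {..<a + b})"
  have "(\<lambda>X. minor_product a N (row_action (a + b) P X) * minor_product a (add_mset h R) X)
      \<in> fun_span (plane_partitions a b c) (pp_product a c)" if "h \<in> ?H" for h
  proof (rule add.IH)
    fix f i assume "f \<in># add_mset h R" "i < a"
    then show "f i < a + b"
      using add.prems(2) PiE_mem[OF that, of i] by auto
  qed (use add.prems in simp)
  then have "(\<lambda>X. \<Sum>h\<in>?H. (\<Prod>i<a. P (f i) (h i)) *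
      (minor_product a N (row_action (a + b) P X) * minor_product a (add_mset h R) X))
      \<in> fun_span (plane_partitions a b c) (pp_product a c)"
    by (rule fun_span_sum)
  moreover have "minor_product a (add_mset f N) (row_action (a + b) P X) * minor_product a R X =
      (\<Sum>h\<in>?H. (\<Prod>i<a. P (f i) (h i)) *
        (minor_product a N (row_action (a + b) P X) * minor_product a (add_mset h R) X))" for X
  proof -
    have "minor a f (row_action (a + b) P X) = (\<Sum>h\<in>?H. (\<Prod>i<a. P (f i) (h i)) * minor a h X)"
      unfolding row_action_def by (rule minor_linear_rows)
    then show ?thesis
      by (simp add: minor_product_def sum_distrib_left sum_distrib_right mult_ac)
  qed
  ultimately show ?case
    by simp
qed

lemma pp_product_row_action:
  "(\<lambda>X. pp_product a c T (row_action (a + b) P X)) \<in> fun_span (plane_partitions a b c) (pp_product a c)"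
proof -
  have "pp_product a c T = (minor_product a (image_mset (layer_rows a T) (mset_set {1..c})) :: _ \<Rightarrow> complex)"
    by (simp add: fun_eq_iff pp_product_def minor_product_def prod_unfold_prod_mset image_mset.compositionality o_def)
  then show ?thesis
    using row_action_product_in_span[of "image_mset (layer_rows a T) (mset_set {1..c})" "{#}" c a b P]
    by (simp add: minor_product_def)
qed

section \<open>The two involutions\<close>

definition interval_reversal :: "nat \<Rightarrow> nat \<Rightarrow> nat \<Rightarrow> nat" where
  "interval_reversal l a i = (if l \<le> i \<and> i < l + a then 2 * l + a - 1 - i else i)"

text \<open>Reversing \<open>a + 2\<close> places is reversing the inner \<open>a\<close> and then
  swapping the ends; the offset \<open>l\<close> lets the induction move inwards. The exponent
  \<open>a * (a - 1) / 2\<close> is kept as a sum to match the shift constant of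
  \<open>sum_layer_rows\<close>.\<close>

lemma interval_reversal_permutes_sign:
  "interval_reversal l a permutes {l..<l + a} \<and> sign (interval_reversal l a) = (-1) ^ (\<Sum>t<a. t)"
proof (induction a arbitrary: l rule: nat_induct2)
  case 0
  have eq: "interval_reversal l 0 = id"
    by (simp add: interval_reversal_def fun_eq_iff)
  show ?case
    unfolding eq by (simp add: permutes_id fun_eq_iff)
next
  case 1
  have eq: "interval_reversal l 1 = id"
    by (auto simp: interval_reversal_def fun_eq_iff)
  show ?case
    unfolding eq by (simp add: permutes_id fun_eq_iff)
next
  case (step a)
  let ?t = "Transposition.transpose l (l + a + 1)"
  have eq: "interval_reversal l (a + 2) = ?t \<circ> interval_reversal (Suc l) a"
    by (auto simp: fun_eq_iff interval_reversal_def Transposition.transpose_def)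
  have t: "?t permutes {l..<l + (a + 2)}"
    by (rule permutes_swap_id) auto
  have r: "interval_reversal (Suc l) a permutes {l..<l + (a + 2)}"
    using step[of "Suc l"] by (auto intro: permutes_subset)
  have "sign (interval_reversal l (a + 2)) = - sign (interval_reversal (Suc l) a)"
    unfolding eq using sign_permutes_compose[OF _ t r] by (simp add: sign_swap_id)
  moreover have "interval_reversal l (a + 2) permutes {l..<l + (a + 2)}"
    unfolding eq by (rule permutes_compose[OF r t])
  moreover have "(\<Sum>t<a + 2. t) = (\<Sum>t<a. t) + 2 * a + 1"
    by (simp add: numeral_2_eq_2)
  ultimately show ?case
    using step[of "Suc l"] by (simp add: power_add power_mult)
qed

lemma minor_reverse:
  "minor a (\<lambda>t. f (a - 1 - t)) X = (-1) ^ (\<Sum>t<a. t) * minor a f X"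
proof -
  let ?\<rho> = "interval_reversal 0 a"
  have "?\<rho> permutes {..<a}" "sign ?\<rho> = (-1) ^ (\<Sum>t<a. t)"
    using interval_reversal_permutes_sign[of 0 a] by (simp_all add: lessThan_atLeast0)
  then have "minor a (f \<circ> ?\<rho>) X = (-1) ^ (\<Sum>t<a. t) * minor a f X"
    by (simp add: minor_permute)
  moreover have "minor a (f \<circ> ?\<rho>) X = minor a (\<lambda>t. f (a - 1 - t)) X"
    by (rule minor_cong) (simp add: interval_reversal_def)
  ultimately show ?thesis by simp
qed

text \<open>Row reversal sends layer \<open>k\<close> of \<open>T\<close> to layer
  \<open>c + 1 - k\<close> of the complement, listed backwards; restoring the order costs one
  reversal sign per layer.\<close>

lemma pp_product_reverse_rows:
  assumes T: "T \<in> plane_partitions a b c"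
  shows "pp_product a c T (\<lambda>r. X (a + b - 1 - r)) =
    ((-1) ^ (\<Sum>t<a. t)) ^ c * pp_product a c (pp_complement a b c T) X"
proof -
  let ?U = "pp_complement a b c T"
  have "minor a (layer_rows a T k) (\<lambda>r. X (a + b - 1 - r)) =
      (-1) ^ (\<Sum>t<a. t) * minor a (layer_rows a ?U (c + 1 - k)) X" if k: "k \<in> {1..c}" for k
  proof -
    have "minor a (layer_rows a T k) (\<lambda>r. X (a + b - 1 - r)) = minor a (\<lambda>t. a + b - 1 - layer_rows a T k t) X"
      by (simp add: minor_def)
    also have "\<dots> = minor a (\<lambda>t. layer_rows a ?U (c + 1 - k) (a - 1 - t)) X"
    proof (rule minor_cong)
      fix t assume "t < a"
      moreover have "c + 1 - k \<in> {1..c}"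
        using k by auto
      ultimately show "a + b - 1 - layer_rows a T k t = layer_rows a ?U (c + 1 - k) (a - 1 - t)"
        using layer_rows_pp_complement[OF T, of "a - 1 - t" "c + 1 - k"] k by auto
    qed
    finally show ?thesis
      by (simp only: minor_reverse)
  qed
  then have "pp_product a c T (\<lambda>r. X (a + b - 1 - r)) =
      ((-1) ^ (\<Sum>t<a. t)) ^ c * (\<Prod>k\<in>{1..c}. minor a (layer_rows a ?U (c + 1 - k)) X)"
    unfolding pp_product_def by (simp add: prod.distrib)
  also have "(\<Prod>k\<in>{1..c}. minor a (layer_rows a ?U (c + 1 - k)) X) = pp_product a c ?U X"
    unfolding pp_product_def
    by (rule prod.reindex_bij_witness[of _ "\<lambda>k. c + 1 - k" "\<lambda>k. c + 1 - k"]) auto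
  finally show ?thesis .
qed

text \<open>Each layer contributes the parity of its row indices. The row lengths give
  \<open>(-1) ^ card T\<close>, and the shifts reproduce exactly the sign found for row
  reversal.\<close>

lemma pp_product_alternate_rows:
  assumes T: "T \<in> plane_partitions a b c"
  shows "pp_product a c T (\<lambda>r j. (-1) ^ r * X r j) =
    ((-1) ^ (\<Sum>t<a. t)) ^ c * ((-1) ^ card T * pp_product a c T X)"
proof -
  have "minor a f (\<lambda>r j. (-1) ^ r * X r j) = (-1) ^ (\<Sum>t<a. f t) * minor a f X" for f
    by (simp add: minor_def prod.distrib sum_distrib_left mult_ac power_sum)
  then have "pp_product a c T (\<lambda>r j. (-1) ^ r * X r j) =
      (\<Prod>k\<in>{1..c}. (-1) ^ (\<Sum>i\<in>{1..a}. row_length T i k) * (-1) ^ (\<Sum>t<a. t)) * pp_product a c T X"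
    by (simp add: pp_product_def prod.distrib sum_layer_rows[OF T] power_add)
  also have "(\<Prod>k\<in>{1..c}. (-1) ^ (\<Sum>i\<in>{1..a}. row_length T i k) * (-1) ^ (\<Sum>t<a. t) :: 'a) =
      (-1) ^ card T * ((-1) ^ (\<Sum>t<a. t)) ^ c"
    by (simp add: prod.distrib card_pp[OF T] power_sum)
  finally show ?thesis
    by (simp only: mult_ac)
qed

text \<open>Matrices are functions on all natural numbers, while the identities between row
  operations are established only for rows below \<open>a + b\<close>; the products see no
  others.\<close>

lemma pp_product_cong:
  assumes T: "T \<in> plane_partitions a b c" and eq: "\<And>r. r < a + b \<Longrightarrow> X r = Y r"
  shows "pp_product a c T X = pp_product a c T Y"
proof -
  have "(\<Prod>t<a. X (layer_rows a T k t) (\<sigma> t)) = (\<Prod>t<a. Y (layer_rows a T k t) (\<sigma> t))" for k \<sigma>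
    using layer_rows_less[OF T] by (intro prod.cong refl) (simp add: eq)
  then show ?thesis
    by (simp add: pp_product_def minor_def)
qed

text \<open>Rows \<open>2m\<close> and \<open>2m + 1\<close> of \<open>mix n\<close> are the eigenvectors \<open>e\<^sub>m \<plusminus> e\<^sub>n\<^sub>-\<^sub>1\<^sub>-\<^sub>m\<close> of the row reversal; for odd \<open>n\<close>
  the last row is twice the middle basis vector, so that its inverse \<open>unmix n\<close> needs no special case.\<close>

definition mix :: "nat \<Rightarrow> nat \<Rightarrow> nat \<Rightarrow> complex" where
  "mix n r l = of_bool (l = r div 2) + (-1) ^ r * of_bool (l = n - 1 - r div 2)"

definition unmix :: "nat \<Rightarrow> nat \<Rightarrow> nat \<Rightarrow> complex" where
  "unmix n r l =
    (if 2 * r < n then (of_bool (l = 2 * r) + of_bool (l = 2 * r + 1)) / 2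
     else (of_bool (l = 2 * (n - 1 - r)) - of_bool (l = 2 * (n - 1 - r) + 1)) / 2)"

lemma row_action_mix:
  assumes "r < n"
  shows "row_action n (mix n) X r j = X (r div 2) j + (-1) ^ r * X (n - 1 - r div 2) j"
  using assms by (simp add: row_action_def mix_def distrib_right sum.distrib of_bool_def if_distrib[of "\<lambda>x. x * _"]
      if_distrib[of "\<lambda>x. _ * x"] cong: if_cong)

lemma row_action_unmix:
  assumes "r < n"
  shows "2 * r + 1 < n \<Longrightarrow> row_action n (unmix n) X r j = (X (2 * r) j + X (2 * r + 1) j) / 2"
    and "2 * r + 1 = n \<Longrightarrow> row_action n (unmix n) X r j = X (2 * r) j / 2"
    and "n \<le> 2 * r \<Longrightarrow> row_action n (unmix n) X r j =
      (X (2 * (n - 1 - r)) j - X (2 * (n - 1 - r) + 1) j) / 2"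
proof -
  \<comment> \<open>For odd \<open>n\<close> the middle row asks for \<open>p = n\<close>, outside
    the range; the zero branch yields its value \<open>X (2 * r) j / 2\<close>.\<close>
  have delta: "(\<Sum>l<n. of_bool (l = p) / 2 * X l j) = (if p < n then X p j / 2 else 0)" for p
  proof -
    have "(\<Sum>l<n. of_bool (l = p) / 2 * X l j) = (\<Sum>l<n. if l = p then X l j / 2 else 0)"
      by (intro sum.cong refl) simp
    then show ?thesis by simp
  qed
  have "row_action n (unmix n) X r j = (\<Sum>l<n. of_bool (l = 2 * r) / 2 * X l j) + (\<Sum>l<n. of_bool (l = 2 * r + 1) / 2 * X l j)"
    if "2 * r < n"
    unfolding row_action_def unmix_def sum.distrib[symmetric]
    using that by (intro sum.cong refl) (simp add: add_divide_distrib distrib_right)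
  then show "2 * r + 1 < n \<Longrightarrow> row_action n (unmix n) X r j = (X (2 * r) j + X (2 * r + 1) j) / 2"
    and "2 * r + 1 = n \<Longrightarrow> row_action n (unmix n) X r j = X (2 * r) j / 2"
    unfolding delta by (simp_all add: add_divide_distrib)
  have "row_action n (unmix n) X r j = (\<Sum>l<n. of_bool (l = 2 * (n - 1 - r)) / 2 * X l j)
      - (\<Sum>l<n. of_bool (l = 2 * (n - 1 - r) + 1) / 2 * X l j)" if "n \<le> 2 * r"
    unfolding row_action_def unmix_def sum_subtractf[symmetric]
    using that by (intro sum.cong refl) (simp add: diff_divide_distrib left_diff_distrib)
  then show "n \<le> 2 * r \<Longrightarrow> row_action n (unmix n) X r j =
      (X (2 * (n - 1 - r)) j - X (2 * (n - 1 - r) + 1) j) / 2"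
    unfolding delta using assms by (simp add: diff_divide_distrib)
qed

lemma unmix_mix:
  assumes r: "r < n"
  shows "row_action n (unmix n) (row_action n (mix n) X) r j = X r j"
proof -
  consider "2 * r + 1 < n" | "2 * r + 1 = n" | "n \<le> 2 * r" by linarith
  then show ?thesis
  proof cases
    case 1
    then show ?thesis
      using r by (simp add: row_action_unmix row_action_mix)
  next
    case 2
    then have "n - 1 - r = r" by simp
    then show ?thesis
      using 2 r by (simp add: row_action_unmix row_action_mix)
  next
    case 3
    then have "2 * (n - 1 - r) + 1 < n" "n - 1 - (n - 1 - r) = r" using r by auto
    then show ?thesis
      using 3 r by (simp add: row_action_unmix row_action_mix)
  qed
qed

lemma mix_unmix:
  assumes r: "r < n"
  shows "row_action n (mix n) (row_action n (unmix n) X) r j = X r j"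
proof -
  define m where "m = r div 2"
  have m: "m < n" "n - 1 - m < n" using r by (auto simp: m_def)
  have inv: "n - 1 - (n - 1 - m) = m" using m by simp
  show ?thesis
  proof (cases "2 * m + 1 < n")
    case True
    then have "n \<le> 2 * (n - 1 - m)" by simp
    note low = row_action_unmix(1)[OF m(1) True] and high = row_action_unmix(3)[OF m(2) this, unfolded inv]
    have "r = 2 * m \<or> r = 2 * m + 1"
      by (auto simp: m_def)
    then show ?thesis
      unfolding row_action_mix[OF r] m_def[symmetric] low high by (auto simp: field_simps)
  next
    case False
    then have "r = 2 * m" "2 * m + 1 = n" "n - 1 - m = m" using r by (auto simp: m_def)
    then show ?thesis
      unfolding row_action_mix[OF r] m_def[symmetric] by (simp add: row_action_unmix(2)[OF m(1)])
  qed
qed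

text \<open>Rows \<open>r\<close> and \<open>n - 1 - r\<close> of \<open>unmix n\<close> differ only
  in the sign of the odd-indexed entry, which is the effect of alternating signs; the middle row for
  odd \<open>n\<close> has only an even-indexed entry.\<close>

lemma unmix_intertwines:
  assumes r: "r < n"
  shows "row_action n (unmix n) X (n - 1 - r) j = row_action n (unmix n) (\<lambda>r j. (-1) ^ r * X r j) r j"
proof -
  have r': "n - 1 - r < n" using r by simp
  consider "2 * r + 1 < n" | "2 * r + 1 = n" | "n \<le> 2 * r" by linarith
  then show ?thesis
  proof cases
    case 1
    then have le: "n \<le> 2 * (n - 1 - r)" and inv: "n - 1 - (n - 1 - r) = r" by auto
    show ?thesis
      unfolding row_action_unmix(1)[OF r 1] row_action_unmix(3)[OF r' le] inv by simp
  next
    case 2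
    then have "n - 1 - r = r" by simp
    then show ?thesis
      using 2 r by (simp add: row_action_unmix(2))
  next
    case 3
    then have "2 * (n - 1 - r) + 1 < n" using r by auto
    then show ?thesis
      unfolding row_action_unmix(3)[OF r 3] using row_action_unmix(1)[OF r'] by simp
  qed
qed

section \<open>From matrices to conjugate linear maps\<close>

text \<open>The rows of \<open>G\<close> and \<open>H\<close> are the images of the basis vectors
  under mutually inverse maps \<open>g\<close> and \<open>h\<close>. The intertwining condition
  compares \<open>g (kappa (e T))\<close> with \<open>nu (g (e T))\<close> coefficient by
  coefficient.\<close>

lemma conjugate_of_intertwining_matrix:
  fixes scale :: "complex \<Rightarrow> 'w::ab_group_add \<Rightarrow> 'w"
  assumes "vector_space scale" and basis: "basis_indexed_by scale S e" and fin: "finite S"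
    and kappa: "Vector_Spaces.linear scale scale kappa" "\<And>T. T \<in> S \<Longrightarrow> kappa (e T) = e (k T)"
      "\<And>T. T \<in> S \<Longrightarrow> k T \<in> S"
    and nu: "Vector_Spaces.linear scale scale nu" "\<And>T. T \<in> S \<Longrightarrow> nu (e T) = scale (s T) (e T)"
    and GH: "\<And>T U. T \<in> S \<Longrightarrow> U \<in> S \<Longrightarrow> (\<Sum>V\<in>S. G T V * H V U) = (if T = U then 1 else 0)"
    and HG: "\<And>T U. T \<in> S \<Longrightarrow> U \<in> S \<Longrightarrow> (\<Sum>V\<in>S. H T V * G V U) = (if T = U then 1 else 0)"
    and intertwine: "\<And>T U. T \<in> S \<Longrightarrow> U \<in> S \<Longrightarrow> G (k T) U = s U * G T U"
  shows "\<exists>g. Vector_Spaces.linear scale scale g \<and> bij g \<and> g \<circ> kappa \<circ> inv g = nu"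
proof -
  interpret vs: vector_space scale by fact
  interpret p: vector_space_pair scale scale by unfold_locales
  have inj: "inj_on e S" and ind: "vs.independent (e ` S)" and span: "vs.span (e ` S) = UNIV"
    using basis by (auto simp: basis_indexed_by_def)
  \<comment> \<open>Extension needs coefficients attached to basis vectors; \<open>inv_into\<close>
    recovers the index because \<open>e\<close> is injective on \<open>S\<close>.\<close>
  have ext: "\<exists>g. Vector_Spaces.linear scale scale g \<and> (\<forall>T\<in>S. g (e T) = (\<Sum>U\<in>S. scale (M T U) (e U)))" for M
    using p.linear_independent_extend[OF ind, of "\<lambda>x. \<Sum>U\<in>S. scale (M (inv_into S e x) U) (e U)"] inj
    by auto
  obtain g where g: "Vector_Spaces.linear scale scale g" "\<And>T. T \<in> S \<Longrightarrow> g (e T) = (\<Sum>U\<in>S. scale (G T U) (e U))"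
    using ext[of G] by blast
  obtain h where h: "Vector_Spaces.linear scale scale h" "\<And>T. T \<in> S \<Longrightarrow> h (e T) = (\<Sum>U\<in>S. scale (H T U) (e U))"
    using ext[of H] by blast
  have agree: "f = f'" if "Vector_Spaces.linear scale scale f" "Vector_Spaces.linear scale scale f'"
    "\<And>T. T \<in> S \<Longrightarrow> f (e T) = f' (e T)" for f f'
    using p.linear_eq_on[OF that(1,2), of _ "e ` S"] that(3) span by (auto simp: fun_eq_iff)
  have apply_sum: "f (\<Sum>U\<in>S. scale (M U) (e U)) = (\<Sum>U\<in>S. scale (M U) (f (e U)))"
    if "Vector_Spaces.linear scale scale f" for f M
    by (simp add: p.linear_sum[OF that] p.linear_scale[OF that])
  have comp: "f' (f (e T)) = e T" if f: "Vector_Spaces.linear scale scale f'"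
    "\<And>T. T \<in> S \<Longrightarrow> f (e T) = (\<Sum>U\<in>S. scale (M T U) (e U))"
    "\<And>T. T \<in> S \<Longrightarrow> f' (e T) = (\<Sum>U\<in>S. scale (M' T U) (e U))"
    "\<And>T U. T \<in> S \<Longrightarrow> U \<in> S \<Longrightarrow> (\<Sum>V\<in>S. M T V * M' V U) = (if T = U then 1 else 0)"
    and T: "T \<in> S" for f f' M M' T
  proof -
    have "f' (f (e T)) = (\<Sum>V\<in>S. \<Sum>U\<in>S. scale (M T V * M' V U) (e U))"
      using T by (simp add: f(2,3) apply_sum[OF f(1)] vs.scale_sum_right)
    also have "\<dots> = (\<Sum>U\<in>S. scale (\<Sum>V\<in>S. M T V * M' V U) (e U))"
      by (subst sum.swap) (simp add: vs.scale_sum_left)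
    also have "\<dots> = (\<Sum>U\<in>S. if T = U then e U else 0)"
      using T by (intro sum.cong refl) (simp add: f(4))
    also have "\<dots> = e T"
      using T fin by simp
    finally show ?thesis .
  qed
  have hg: "h \<circ> g = id"
    by (rule agree) (use comp[OF h(1) g(2) h(2) GH] Vector_Spaces.linear_compose[OF g(1) h(1)] vs.linear_id in auto)
  have gh: "g \<circ> h = id"
    by (rule agree) (use comp[OF g(1) h(2) g(2) HG] Vector_Spaces.linear_compose[OF h(1) g(1)] vs.linear_id in auto)
  have "g \<circ> kappa = nu \<circ> g"
  proof (rule agree)
    fix T assume T: "T \<in> S"
    then show "(g \<circ> kappa) (e T) = (nu \<circ> g) (e T)"
      by (simp add: kappa(2,3) g(2) apply_sum[OF nu(1)] nu(2) intertwine mult.commute)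
  qed (use Vector_Spaces.linear_compose[OF kappa(1) g(1)] Vector_Spaces.linear_compose[OF g(1) nu(1)] in simp_all)
  moreover have "bij g"
    using gh hg by (intro o_bij)
  moreover have "inv g = h"
    using gh hg by (intro inv_unique_comp)
  ultimately have "g \<circ> kappa \<circ> inv g = nu"
    using gh by (simp add: o_assoc[symmetric])
  then show ?thesis
    using g(1) \<open>bij g\<close> by blast
qed

theorem mainTheorem2:
  fixes a b c :: nat
    and scale :: "complex \<Rightarrow> 'w::ab_group_add \<Rightarrow> 'w"
    and e :: "(nat \<times> nat \<times> nat) set \<Rightarrow> 'w"
    and kappa nu :: "'w \<Rightarrow> 'w"
  assumes "a > 0" and "b > 0" and "c > 0"
    and "vector_space scale"
    and "basis_indexed_by scale (plane_partitions a b c) e"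
    and "Vector_Spaces.linear scale scale kappa"
    and "\<And>T. T \<in> plane_partitions a b c \<Longrightarrow> kappa (e T) = e (pp_complement a b c T)"
    and "Vector_Spaces.linear scale scale nu"
    and "\<And>T. T \<in> plane_partitions a b c \<Longrightarrow> nu (e T) = scale ((-1) ^ card T) (e T)"
  shows "\<exists>g. Vector_Spaces.linear scale scale g \<and> bij g \<and> g \<circ> kappa \<circ> inv g = nu"
proof -
  let ?S = "plane_partitions a b c" and ?n = "a + b" and ?k = "pp_complement a b c"
  let ?p = "pp_product a c :: _ \<Rightarrow> (nat \<Rightarrow> nat \<Rightarrow> complex) \<Rightarrow> complex"
  let ?\<alpha> = "row_action ?n (mix ?n)" and ?\<beta> = "row_action ?n (unmix ?n)"
  let ?J = "\<lambda>X :: nat \<Rightarrow> nat \<Rightarrow> complex. \<lambda>r. X (?n - 1 - r)"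
  let ?D = "\<lambda>X :: nat \<Rightarrow> nat \<Rightarrow> complex. \<lambda>r j. (-1) ^ r * X r j"
  \<comment> \<open>The sign common to row reversal and row alternation; being a power of
    \<open>-1\<close>, it can be cancelled.\<close>
  define \<epsilon> :: complex where "\<epsilon> = ((-1) ^ (\<Sum>t<a. t)) ^ c"
  have matrix: "\<exists>M. \<forall>T X. ?p T (row_action ?n P X) = (\<Sum>U\<in>?S. M T U * ?p U X)" for P
  proof -
    have "\<forall>T. \<exists>d. \<forall>X. ?p T (row_action ?n P X) = (\<Sum>U\<in>?S. d U * ?p U X)"
      using pp_product_row_action[of a c _ b P] unfolding fun_span_def by blast
    then show ?thesis
      by (rule choice)
  qed
  obtain G where G: "\<And>T X. ?p T (?\<beta> X) = (\<Sum>U\<in>?S. G T U * ?p U X)"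
    using matrix[of "unmix ?n"] by blast
  obtain H where H: "\<And>T X. ?p T (?\<alpha> X) = (\<Sum>U\<in>?S. H T U * ?p U X)"
    using matrix[of "mix ?n"] by blast
  \<comment> \<open>By independence, identities between functions of \<open>X\<close> become
    identities between coefficients.\<close>
  have coeffs: "d U = d' U" if "\<And>X. (\<Sum>U\<in>?S. d U * ?p U X) = (\<Sum>U\<in>?S. d' U * ?p U X)" "U \<in> ?S" for d d' U
  proof -
    have "(\<Sum>U\<in>?S. (d U - d' U) * ?p U X) = 0" for X
      by (simp add: left_diff_distrib sum_subtractf that(1))
    then show ?thesis
      using pp_products_independent[where d = "\<lambda>U. d U - d' U", OF _ that(2)] by simp
  qed
  \<comment> \<open>Expanding first for \<open>f\<close> and then for \<open>f'\<close> multiplies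
    the coefficient matrices, so inverse row operations have inverse matrices.\<close>
  have inverse: "(\<Sum>V\<in>?S. M T V * M' V U) = (if T = U then 1 else 0)"
    if M: "\<And>T X. ?p T (f X) = (\<Sum>U\<in>?S. M T U * ?p U X)"
      and M': "\<And>T X. ?p T (f' X) = (\<Sum>U\<in>?S. M' T U * ?p U X)"
      and ff': "\<And>X. ?p T (f (f' X)) = ?p T X" and T: "T \<in> ?S" and U: "U \<in> ?S" for M M' f f' T U
  proof (rule coeffs[OF _ U])
    fix X
    have "(\<Sum>U\<in>?S. (\<Sum>V\<in>?S. M T V * M' V U) * ?p U X) = (\<Sum>V\<in>?S. M T V * ?p V (f' X))"
      by (simp add: M' sum_distrib_left sum_distrib_right mult.assoc) (rule sum.swap)
    also have "\<dots> = ?p T X"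
      by (simp add: M[symmetric] ff')
    also have "\<dots> = (\<Sum>U\<in>?S. (if T = U then 1 else 0) * ?p U X)"
      using T by (simp add: finite_plane_partitions if_distrib[of "\<lambda>x. x * _"] cong: if_cong)
    finally show "(\<Sum>U\<in>?S. (\<Sum>V\<in>?S. M T V * M' V U) * ?p U X) = (\<Sum>U\<in>?S. (if T = U then 1 else 0) * ?p U X)" .
  qed
  \<comment> \<open>The product of \<open>T\<close> at the reversed rows of
    \<open>?\<beta> X\<close> is computed in two ways: directly, which brings in the complement, and
    through \<open>unmix_intertwines\<close>, which brings in the alternating signs.\<close>
  have intertwine: "G (?k T) U = (-1) ^ card U * G T U" if T: "T \<in> ?S" and U: "U \<in> ?S" for T U
  proof (rule coeffs[OF _ U])
    fix X
    have "\<epsilon> * ?p (?k T) (?\<beta> X) = ?p T (?J (?\<beta> X))"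
      unfolding \<epsilon>_def by (rule pp_product_reverse_rows[OF T, symmetric])
    also have "\<dots> = ?p T (?\<beta> (?D X))"
      by (rule pp_product_cong[OF T]) (use unmix_intertwines in \<open>simp add: fun_eq_iff\<close>)
    also have "\<dots> = (\<Sum>U\<in>?S. G T U * (\<epsilon> * ((-1) ^ card U * ?p U X)))"
      unfolding G \<epsilon>_def by (intro sum.cong refl) (simp only: pp_product_alternate_rows)
    also have "\<dots> = \<epsilon> * (\<Sum>U\<in>?S. (-1) ^ card U * G T U * ?p U X)"
      by (simp add: sum_distrib_left mult_ac)
    finally show "(\<Sum>U\<in>?S. G (?k T) U * ?p U X) = (\<Sum>U\<in>?S. (-1) ^ card U * G T U * ?p U X)"
      by (simp add: G[symmetric] \<epsilon>_def)
  qed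
  show ?thesis
  proof (rule conjugate_of_intertwining_matrix[OF assms(4,5) finite_plane_partitions assms(6,7) _ assms(8,9)])
    show "(\<Sum>V\<in>?S. G T V * H V U) = (if T = U then 1 else 0)" if "T \<in> ?S" "U \<in> ?S" for T U
      by (rule inverse[OF G H _ that]) (rule pp_product_cong[OF that(1)], simp add: fun_eq_iff unmix_mix)
    show "(\<Sum>V\<in>?S. H T V * G V U) = (if T = U then 1 else 0)" if "T \<in> ?S" "U \<in> ?S" for T U
      by (rule inverse[OF H G _ that]) (rule pp_product_cong[OF that(1)], simp add: fun_eq_iff mix_unmix)
  qed (use pp_complement_mem intertwine in auto)
qed

end
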